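(* Let $V$ be a vertex algebra, $\varphi$ a locally finite automorphism of $V$, and $W$ a $\varphi$-twisted $V$-module. Write $\varphi=\sigma e^{-2\pi \mathrm{i}\mathcal N}$ with $\sigma\in\mathrm{Aut}(V)$ semisimple, $\mathcal N\in\mathrm{Der}(V)$ locally nilpotent and $\sigma\mathcal N=\mathcal N\sigma$. Then for all $\alpha,\beta\in\mathbb C/\mathbb Z$, $a\in V_\alpha$, $b\in V_\beta$, $v\in W$, $m\in\alpha$, $k\in\beta$, $n\in\mathbb Z$, the following Borcherds identity holds: $$\sum_{i=0}^\infty (-1)^i\binom{n}{i}\, a_{(m+n-i+\mathcal N)}\bigl(b_{(k+i+\mathcal N)}v\bigr)-\sum_{i=0}^\infty(-1)^{n+i}\binom{n}{i}\, b_{(k+n-i+\mathcal N)}\bigl(a_{(m+i+\mathcal N)}v\bigr)=\sum_{j=0}^\infty\Bigl(\Bigl(\binom{m+\mathcal N}{j}a\Bigr)_{(n+j)}b\Bigr)_{(m+k-j+\mathcal N)}v .$$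
   Context: All vector spaces are over $\mathbb C$, $\mathrm i=\sqrt{-1}$; $x^{(k)}=x^k/k!$, in particular $D^{(k)}=D^k/k!$ for an operator $D$. $z,z_1,z_2,\dots$ are commuting formal variables, $\zeta,\zeta_1,\zeta_2,\dots$ are further formal variables (thought of as $\zeta=\log z$, $\zeta_i=\log z_i$), and $z_{ij}=z_i-z_j$. Put $D_z=\partial_z+z^{-1}\partial_\zeta$, $D_\zeta=z\partial_z+\partial_\zeta$, and similarly $D_{z_i},D_{\zeta_i}$. Logarithmic fields. For a vector space $W$ and $\alpha\in\mathbb C/\mathbb Z$, $W[\zeta][[z]]z^{-\alpha}$ is the space of formal series $\sum_{i\ge0}w_i(\zeta)z^{i-m}$ with $w_i(\zeta)\in W[\zeta]$, $m\in\alpha$. Let $\mathrm{LFie}_\alpha(W)=\mathrm{Hom}_{\mathbb C}(W,W[\zeta][[z]]z^{-\alpha})$ and $\mathrm{LFie}(W)=\bigoplus_{\alpha\in\mathbb C/\mathbb Z}\mathrm{LFie}_\alpha(W)$; its elements, written $a(z)$ or $a(\zeta,z)$, are called logarithmic fields. Two logarithmic fields $a,b$ are local if $z_{12}^N a(z_1)b(z_2)=z_{12}^N b(z_2)a(z_1)$ for some integer $N\ge0$. For local $a,b$ and $n\in\mathbb Z$, the $n$-th product is the logarithmic field given by $(a_{(n)}b)(z)v=D_{z_1}^{(N-1-n)}\bigl(z_{12}^N a(z_1)b(z_2)v\bigr)\big|_{z_1=z_2=z,\ \zeta_1=\zeta_2=\zeta}$ ($v\in W$) for $n\le N-1$, and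 $a_{(n)}b=0$ for $n\ge N$ (independent of the choice of $N$). A local collection is a set of logarithmic fields in which every pair is local. Twisted modules. $V$ is a vertex algebra with vacuum $\mathbf 1$ and products $a_{(n)}b$ ($n\in\mathbb Z$). $\mathrm{Aut}(V)$ (resp. $\mathrm{Der}(V)$) is the set of invertible linear maps preserving all $n$-th products (resp. linear maps that are derivations of all $n$-th products). For $\varphi\in\mathrm{Aut}(V)$, a $\varphi$-twisted $V$-module is a vector space $W$ with a linear map $Y\colon V\to\mathrm{LFie}(W)$, $a\mapsto Y(a,z)$, such that $Y(\mathbf 1)=I$ (identity operator), $Y(V)$ is a local collection, $Y(\varphi a,z)=e^{2\pi\mathrm iD_\zeta}Y(a,z)$, and $Y(a_{(n)}b,z)=Y(a,z)_{(n)}Y(b,z)$ for all $a,b\in V$, $n\in\mathbb Z$. Here $e^{2\pi\mathrm iD_\zeta}$ sends $\zeta\mapsto\zeta+2\pi\mathrm i$ and $z^\gamma\mapsto e^{2\pi\mathrm i\gamma}z^\gamma$. Local finiteness and modes. $\varphi$ is locally finite if every $a\in V$ lies in a finite-dimensional $\varphi$-invariant subspace; such an automorphism has a unique decomposition $\varphi=\sigma e^{-2\pi\mathrm i\mathcal N}$ with commuting semisimple $\sigma\in\mathrm{Aut}(V)$ and locally nilpotent $\mathcal N\in\mathrm{Der}(V)$ (locally nilpotent: each $a$ is killed by a power of $\mathcal N$). For $\alpha\in\mathbb C/\mathbb Z$, $V_\alpha=\{a\in V\mid\sigma a=e^{-2\pi\mathrm i\alpha}a\}$. Put $z^{m+\mathcal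 N}a=z^me^{\zeta\mathcal N}a$ and extend $Y$ linearly over polynomials in $\zeta$ and powers of $z$. Set $X(a,z)=Y(e^{\zeta\mathcal N}a,z)$, which equals $Y(a,z)|_{\zeta=0}$. For $a\in V_\alpha$, $m\in\alpha$, the $(m+\mathcal N)$-th mode of $a$ is $a_{(m+\mathcal N)}=\mathrm{Res}_z\,z^mX(a,z)=\mathrm{Res}_z\,Y(z^{m+\mathcal N}a,z)\in\mathrm{End}(W)$, where $\mathrm{Res}_z$ is the coefficient of $z^{-1}$. Finally $\binom{m+\mathcal N}{j}=\frac1{j!}(m+\mathcal N)(m+\mathcal N-1)\cdots(m+\mathcal N-j+1)$ as an operator on $V$. All sums in the identity are finite. *)

theory Defs
  imports Complex_Main "HOL-Library.Groups_Big_Fun"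
begin

text \<open>
  Complex vector spaces are types of class \<open>ab_group_add\<close> together with a scalar multiplication
  satisfying \<^locale>\<open>vector_space\<close>. Sums written with \<^const>\<open>Sum_any\<close> range over an infinite
  index type; they are the honest sums when finitely many terms are nonzero, as is
  the case wherever they are used below.
\<close>

section \<open>Vertex algebras\<close>

locale vertex_algebra = vector_space scale
  for scale :: "complex \<Rightarrow> 'v::ab_group_add \<Rightarrow> 'v" +
  fixes vac :: 'v
    and prd :: "int \<Rightarrow> 'v \<Rightarrow> 'v \<Rightarrow> 'v"  \<comment> \<open>\<open>prd n a b\<close> is $a_{(n)}b$\<close>
  assumes prd_linear_left: "Vector_Spaces.linear scale scale (\<lambda>a. prd n a b)"
    and prd_linear_right: "Vector_Spaces.linear scale scale (\<lambda>b. prd n a b)"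
    and prd_truncation: "\<exists>n0. \<forall>n\<ge>n0. prd n a b = 0"
    and vac_prd: "prd n vac a = (if n = -1 then a else 0)"
    and prd_vac: "n \<ge> -1 \<Longrightarrow> prd n a vac = (if n = -1 then a else 0)"
    and Borcherds:
      "Sum_any (\<lambda>j. scale (of_int m gchoose j) (prd (m + k - int j) (prd (n + int j) a b) c)) =
       Sum_any (\<lambda>i. scale ((-1) ^ i * (of_int n gchoose i))
         (prd (m + n - int i) a (prd (k + int i) b c))) -
       Sum_any (\<lambda>i. scale ((-1) powi (n + int i) * (of_int n gchoose i))
         (prd (k + n - int i) b (prd (m + int i) a c)))"

definition Aut :: "(complex \<Rightarrow> 'v::ab_group_add \<Rightarrow> 'v) \<Rightarrow> (int \<Rightarrow> 'v \<Rightarrow> 'v \<Rightarrow> 'v) \<Rightarrow> ('v \<Rightarrow> 'v) set" where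
  "Aut scale prd = {\<phi>. Vector_Spaces.linear scale scale \<phi> \<and> bij \<phi> \<and>
     (\<forall>n a b. \<phi> (prd n a b) = prd n (\<phi> a) (\<phi> b))}"

definition Der :: "(complex \<Rightarrow> 'v::ab_group_add \<Rightarrow> 'v) \<Rightarrow> (int \<Rightarrow> 'v \<Rightarrow> 'v \<Rightarrow> 'v) \<Rightarrow> ('v \<Rightarrow> 'v) set" where
  "Der scale prd = {\<delta>. Vector_Spaces.linear scale scale \<delta> \<and>
     (\<forall>n a b. \<delta> (prd n a b) = prd n (\<delta> a) b + prd n a (\<delta> b))}"

section \<open>Linear operators\<close>

definition locally_finite_op :: "(complex \<Rightarrow> 'v::ab_group_add \<Rightarrow> 'v) \<Rightarrow> ('v \<Rightarrow> 'v) \<Rightarrow> bool" where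
  "locally_finite_op scale \<phi> \<longleftrightarrow>
     (\<forall>a. \<exists>S B. a \<in> S \<and> finite B \<and> S = module.span scale B \<and> \<phi> ` S \<subseteq> S)"

definition locally_nilpotent_op :: "('v::zero \<Rightarrow> 'v) \<Rightarrow> bool" where
  "locally_nilpotent_op \<N> \<longleftrightarrow> (\<forall>a. \<exists>r. (\<N> ^^ r) a = 0)"

text \<open>
  Semisimple: every invariant subspace has an invariant complement. Over the complex numbers
  (in any dimension) this says that the space is the direct sum of the eigenspaces.
\<close>
definition semisimple_op :: "(complex \<Rightarrow> 'v::ab_group_add \<Rightarrow> 'v) \<Rightarrow> ('v \<Rightarrow> 'v) \<Rightarrow> bool" where
  "semisimple_op scale \<sigma> \<longleftrightarrow>
     (\<forall>S. module.subspace scale S \<and> \<sigma> ` S \<subseteq> S \<longrightarrow>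
       (\<exists>T. module.subspace scale T \<and> \<sigma> ` T \<subseteq> T \<and> S \<inter> T = {0} \<and>
            (\<forall>a. \<exists>s\<in>S. \<exists>t\<in>T. a = s + t)))"

text \<open>$e^{c\mathcal N}$ for a locally nilpotent operator\<close>
definition exp_op :: "(complex \<Rightarrow> 'v::ab_group_add \<Rightarrow> 'v) \<Rightarrow> complex \<Rightarrow> ('v \<Rightarrow> 'v) \<Rightarrow> 'v \<Rightarrow> 'v" where
  "exp_op scale c \<N> a = Sum_any (\<lambda>r. scale (c ^ r / fact r) ((\<N> ^^ r) a))"

text \<open>$(m+\mathcal N)(m+\mathcal N-1)\cdots(m+\mathcal N-j+1)$\<close>
primrec falling_op ::
  "(complex \<Rightarrow> 'v::ab_group_add \<Rightarrow> 'v) \<Rightarrow> complex \<Rightarrow> ('v \<Rightarrow> 'v) \<Rightarrow> nat \<Rightarrow> 'v \<Rightarrow> 'v" where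
  "falling_op scale m \<N> 0 a = a"
| "falling_op scale m \<N> (Suc j) a = falling_op scale m \<N> j (scale (m - of_nat j) a + \<N> a)"

definition binom_op ::
  "(complex \<Rightarrow> 'v::ab_group_add \<Rightarrow> 'v) \<Rightarrow> complex \<Rightarrow> ('v \<Rightarrow> 'v) \<Rightarrow> nat \<Rightarrow> 'v \<Rightarrow> 'v" where
  "binom_op scale m \<N> j a = scale (1 / fact j) (falling_op scale m \<N> j a)"

section \<open>Formal series\<close>

text \<open>Elements of $\mathbb C/\mathbb Z$ are cosets, i.e. subsets of $\mathbb C$.\<close>
definition CmodZ :: "complex set set" where
  "CmodZ = UNIV // {(x, y). x - y \<in> \<int>}"

text \<open>
  \<open>f \<gamma> l\<close> is the coefficient of $z^\gamma\zeta^l$; in two variables, \<open>F \<gamma>1 l1 \<gamma>2 l2\<close> is the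
  coefficient of $z_1^{\gamma_1}\zeta_1^{l_1}z_2^{\gamma_2}\zeta_2^{l_2}$.
\<close>
type_synonym 'w series = "complex \<Rightarrow> nat \<Rightarrow> 'w"
type_synonym 'w series2 = "complex \<Rightarrow> nat \<Rightarrow> complex \<Rightarrow> nat \<Rightarrow> 'w"

text \<open>$W[\zeta][[z]]z^{-\alpha}$\<close>
definition log_series :: "complex set \<Rightarrow> 'w::zero series set" where
  "log_series \<alpha> = {f. (\<exists>m\<in>\<alpha>. \<forall>\<gamma> l. f \<gamma> l \<noteq> 0 \<longrightarrow> (\<exists>i::nat. \<gamma> = of_nat i - m)) \<and>
     (\<forall>\<gamma>. finite {l. f \<gamma> l \<noteq> 0})}"

text \<open>Multiplication by $z^m$\<close>
definition mult_z_pow :: "complex \<Rightarrow> 'w series \<Rightarrow> 'w series" where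
  "mult_z_pow m f = (\<lambda>\<gamma> l. f (\<gamma> - m) l)"

text \<open>$\mathrm{Res}_z$, with values in the polynomials in $\zeta$ (as coefficient sequences)\<close>
definition Res_z :: "'w series \<Rightarrow> nat \<Rightarrow> 'w" where
  "Res_z f = f (-1)"

text \<open>$e^{2\pi\mathrm i D_\zeta}$: $z^\gamma\zeta^k \mapsto e^{2\pi\mathrm i\gamma}z^\gamma(\zeta+2\pi\mathrm i)^k$\<close>
definition monodromy :: "(complex \<Rightarrow> 'w::ab_group_add \<Rightarrow> 'w) \<Rightarrow> 'w series \<Rightarrow> 'w series" where
  "monodromy scale f = (\<lambda>\<gamma> l. scale (exp (2 * pi * \<i> * \<gamma>))
     (Sum_any (\<lambda>k. scale (of_nat (k choose l) * (2 * pi * \<i>) ^ (k - l)) (f \<gamma> k))))"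

text \<open>Multiplication by $z_{12}=z_1-z_2$\<close>
definition mult_z12 :: "'w::ab_group_add series2 \<Rightarrow> 'w series2" where
  "mult_z12 F = (\<lambda>\<gamma>1 l1 \<gamma>2 l2. F (\<gamma>1 - 1) l1 \<gamma>2 l2 - F \<gamma>1 l1 (\<gamma>2 - 1) l2)"

text \<open>$D_{z_1}=\partial_{z_1}+z_1^{-1}\partial_{\zeta_1}$\<close>
definition D_z1 :: "(complex \<Rightarrow> 'w::ab_group_add \<Rightarrow> 'w) \<Rightarrow> 'w series2 \<Rightarrow> 'w series2" where
  "D_z1 scale F = (\<lambda>\<gamma>1 l1 \<gamma>2 l2. scale (\<gamma>1 + 1) (F (\<gamma>1 + 1) l1 \<gamma>2 l2) +
     scale (of_nat (l1 + 1)) (F (\<gamma>1 + 1) (l1 + 1) \<gamma>2 l2))"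

text \<open>The specialization $z_1=z_2=z$, $\zeta_1=\zeta_2=\zeta$\<close>
definition diag :: "'w::ab_group_add series2 \<Rightarrow> 'w series" where
  "diag F = (\<lambda>\<gamma> l. Sum_any (\<lambda>\<gamma>1. \<Sum>l1\<le>l. F \<gamma>1 l1 (\<gamma> - \<gamma>1) (l - l1)))"

section \<open>Logarithmic fields\<close>

type_synonym 'w lfield = "'w \<Rightarrow> 'w series"

definition LFie_comp ::
  "(complex \<Rightarrow> 'w::ab_group_add \<Rightarrow> 'w) \<Rightarrow> complex set \<Rightarrow> 'w lfield set" where
  "LFie_comp scale \<alpha> = {a. (\<forall>\<gamma> l. Vector_Spaces.linear scale scale (\<lambda>v. a v \<gamma> l)) \<and>
     (\<forall>v. a v \<in> log_series \<alpha>)}"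

definition LFie :: "(complex \<Rightarrow> 'w::ab_group_add \<Rightarrow> 'w) \<Rightarrow> 'w lfield set" where
  "LFie scale = {a. \<exists>A c. finite A \<and> A \<subseteq> CmodZ \<and> (\<forall>\<alpha>\<in>A. c \<alpha> \<in> LFie_comp scale \<alpha>) \<and>
     a = (\<lambda>v \<gamma> l. \<Sum>\<alpha>\<in>A. c \<alpha> v \<gamma> l)}"

definition id_field :: "'w::zero lfield" where
  "id_field v = (\<lambda>\<gamma> l. if \<gamma> = 0 \<and> l = 0 then v else 0)"

text \<open>$a(z_1)b(z_2)v$ and $b(z_2)a(z_1)v$\<close>
definition prod12 :: "'w lfield \<Rightarrow> 'w lfield \<Rightarrow> 'w \<Rightarrow> 'w series2" where
  "prod12 a b v = (\<lambda>\<gamma>1 l1 \<gamma>2 l2. a (b v \<gamma>2 l2) \<gamma>1 l1)"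

definition prod21 :: "'w lfield \<Rightarrow> 'w lfield \<Rightarrow> 'w \<Rightarrow> 'w series2" where
  "prod21 a b v = (\<lambda>\<gamma>1 l1 \<gamma>2 l2. b (a v \<gamma>1 l1) \<gamma>2 l2)"

definition local_with :: "nat \<Rightarrow> 'w::ab_group_add lfield \<Rightarrow> 'w lfield \<Rightarrow> bool" where
  "local_with N a b \<longleftrightarrow>
     (\<forall>v. (mult_z12 ^^ N) (prod12 a b v) = (mult_z12 ^^ N) (prod21 a b v))"

definition local_pair :: "'w::ab_group_add lfield \<Rightarrow> 'w lfield \<Rightarrow> bool" where
  "local_pair a b \<longleftrightarrow> (\<exists>N. local_with N a b)"

definition local_collection ::
  "(complex \<Rightarrow> 'w::ab_group_add \<Rightarrow> 'w) \<Rightarrow> 'w lfield set \<Rightarrow> bool" where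
  "local_collection scale C \<longleftrightarrow> C \<subseteq> LFie scale \<and> (\<forall>a\<in>C. \<forall>b\<in>C. local_pair a b)"

text \<open>
  The $n$-th product computed with exponent \<open>N\<close>. For local \<open>a\<close>, \<open>b\<close> it does not depend on the
  \<open>N\<close> with \<open>local_with N a b\<close>, so \<open>field_prd\<close> uses the least one.
\<close>
definition field_prd_with ::
  "(complex \<Rightarrow> 'w::ab_group_add \<Rightarrow> 'w) \<Rightarrow> nat \<Rightarrow> int \<Rightarrow> 'w lfield \<Rightarrow> 'w lfield \<Rightarrow> 'w lfield" where
  "field_prd_with scale N n a b v =
     (if n \<le> int N - 1 then
        let j = nat (int N - 1 - n) in
        diag (\<lambda>\<gamma>1 l1 \<gamma>2 l2. scale (1 / fact j)
          ((D_z1 scale ^^ j) ((mult_z12 ^^ N) (prod12 a b v)) \<gamma>1 l1 \<gamma>2 l2))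
      else (\<lambda>\<gamma> l. 0))"

definition field_prd ::
  "(complex \<Rightarrow> 'w::ab_group_add \<Rightarrow> 'w) \<Rightarrow> int \<Rightarrow> 'w lfield \<Rightarrow> 'w lfield \<Rightarrow> 'w lfield" where
  "field_prd scale n a b = field_prd_with scale (LEAST N. local_with N a b) n a b"

section \<open>Twisted modules\<close>

locale twisted_module =
  V: vertex_algebra scaleV vac prd + W: vector_space scaleW
  for scaleV :: "complex \<Rightarrow> 'v::ab_group_add \<Rightarrow> 'v"
    and vac :: 'v
    and prd :: "int \<Rightarrow> 'v \<Rightarrow> 'v \<Rightarrow> 'v"
    and scaleW :: "complex \<Rightarrow> 'w::ab_group_add \<Rightarrow> 'w" +
  fixes \<phi> :: "'v \<Rightarrow> 'v"
    and Y :: "'v \<Rightarrow> 'w lfield"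
  assumes aut: "\<phi> \<in> Aut scaleV prd"
    and Y_linear: "Vector_Spaces.linear scaleV scaleW (\<lambda>a. Y a v \<gamma> l)"
    and Y_field: "Y a \<in> LFie scaleW"
    and Y_vac: "Y vac = id_field"
    and Y_local: "local_collection scaleW (range Y)"
    and Y_equivariant: "Y (\<phi> a) v = monodromy scaleW (Y a v)"
    and Y_prd: "Y (prd n a b) = field_prd scaleW n (Y a) (Y b)"

definition eigenspace_mod ::
  "(complex \<Rightarrow> 'v::ab_group_add \<Rightarrow> 'v) \<Rightarrow> ('v \<Rightarrow> 'v) \<Rightarrow> complex set \<Rightarrow> 'v set" where
  "eigenspace_mod scale \<sigma> \<alpha> = {a. \<forall>m\<in>\<alpha>. \<sigma> a = scale (exp (- (2 * pi * \<i> * m))) a}"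

text \<open>
  $X(a,z)=Y(e^{\zeta\mathcal N}a,z)=\sum_r \frac{\zeta^r}{r!}Y(\mathcal N^r a,z)$
\<close>
definition X_field ::
  "(complex \<Rightarrow> 'w::ab_group_add \<Rightarrow> 'w) \<Rightarrow> ('v \<Rightarrow> 'w lfield) \<Rightarrow> ('v \<Rightarrow> 'v) \<Rightarrow> 'v \<Rightarrow> 'w lfield" where
  "X_field scaleW Y \<N> a v =
     (\<lambda>\<gamma> l. \<Sum>r\<le>l. scaleW (1 / fact r) (Y ((\<N> ^^ r) a) v \<gamma> (l - r)))"

text \<open>
  \<open>mode scaleW Y \<N> m a\<close> is $a_{(m+\mathcal N)}$. Since $X(a,z)$ does not involve $\zeta$, the
  residue is a constant polynomial in $\zeta$, read off as its coefficient of $\zeta^0$.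
\<close>
definition mode ::
  "(complex \<Rightarrow> 'w::ab_group_add \<Rightarrow> 'w) \<Rightarrow> ('v \<Rightarrow> 'w lfield) \<Rightarrow> ('v \<Rightarrow> 'v) \<Rightarrow>
   complex \<Rightarrow> 'v \<Rightarrow> 'w \<Rightarrow> 'w" where
  "mode scaleW Y \<N> m a v = Res_z (mult_z_pow m (X_field scaleW Y \<N> a v)) 0"

end

theory Submission
  imports Defs
begin

text \<open>
  Fix \<open>a\<close> with $\sigma a=e^{-2\pi i m}a$. The mode $a_{(m+\mathcal N)}$ is the coefficient of
  $z^{-1-m}\zeta^0$ in \<open>Y(a,z)\<close>, so the identity only concerns coefficients free of logarithms. By
  locality there is an \<open>M\<close> for which the two series $z_{12}^M Y(a,z_1)Y(b,z_2)v$ and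
  $z_{12}^M Y(b,z_2)Y(a,z_1)v$ agree. Their common value $F_a$ has exponents bounded below in both
  variables: in $z_2$ because of the first form and in $z_1$ because of the second.

  The two sums on the left are the residues of $z_1^m z_2^k z_{12}^n Y(a,z_1)Y(b,z_2)v$ and
  $z_1^m z_2^k z_{12}^n Y(b,z_2)Y(a,z_1)v$, where $z_{12}^n$ is expanded for $|z_1|>|z_2|$ and for
  $|z_2|>|z_1|$. The Pascal rule moves $z_{12}^M$ from the power into the series
  (\<open>res12_mult_z12\<close>, \<open>res21_mult_z12\<close>), so both become residues of $z_{12}^{n-M}F_a$. If
  \<open>n \<ge> M\<close>, then the two expansions agree and all products on the right vanish. If \<open>n = M - 1 - J\<close>
  with \<open>J \<ge> 0\<close>, the difference of the two expansions of $z_{12}^{-1-J}$ is a derivative of the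
  formal delta function, which gives (\<open>res12_diff_res21\<close>)
  $$\sum_g\binom{g+m}{J}\,[z_1^g z_2^{J-1-m-k-g}]\,F_a .$$

  On the right, the \<open>j\<close>-th term is a coefficient of $D_{z_1}^{(J-j)}F_x$ on the diagonal, where
  $x=\binom{m+\mathcal N}{j}a$ and $F_x$ is the series for \<open>x\<close> in place of \<open>a\<close>. Equivariance under $\varphi$ forces
  $Y(a,z)=X(e^{-\zeta\mathcal N}a,z)$ with \<open>X\<close> free of logarithms and with exponents in \<open>-m + \<int>\<close>
  (\<open>log_structure\<close>): a polynomial in $\zeta$ that is a scalar multiple of its shift by $2\pi i$ is
  constant. Hence $D_{z_1}$ acts on the coefficient of $z_1^g$ as $g-\mathcal N$
  acts on \<open>a\<close> (\<open>D_z1_funpow_local_series\<close>), and the right-hand side is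
  $$\sum_g\sum_j\,[z_1^g z_2^{J-1-m-k-g}]\,F_{\binom{g-\mathcal N}{J-j}\binom{m+\mathcal N}{j}a}.$$
  By Vandermonde (\<open>falling_op_Vandermonde\<close>) the operator $\mathcal N$ cancels and the inner sum is
  $\binom{g+m}{J}F_a$, so the two sides agree.
\<close>

section \<open>Finitely supported sums\<close>

lemma Sum_any_reindex_bij:
  assumes "bij h"
  shows "Sum_any (\<lambda>x. g (h x)) = Sum_any g"
  using Sum_any.reindex_cong [OF assms, of g "\<lambda>x. g (h x)"] by (simp add: comp_def)

lemma Sum_any_diff:
  fixes f g :: "'i \<Rightarrow> 'a::ab_group_add"
  assumes "finite {x. f x \<noteq> 0}" "finite {x. g x \<noteq> 0}"
  shows "Sum_any (\<lambda>x. f x - g x) = Sum_any f - Sum_any g"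
proof -
  have fin: "finite ({x. f x \<noteq> 0} \<union> {x. g x \<noteq> 0})" using assms by simp
  have "{x. f x - g x \<noteq> 0} \<subseteq> {x. f x \<noteq> 0} \<union> {x. g x \<noteq> 0}" by auto
  with fin show ?thesis
    by (subst (1 2 3) Sum_any.expand_superset[OF fin]) (auto simp: sum_subtractf)
qed

lemma Sum_any_shift_diff:
  fixes g :: "complex \<Rightarrow> 'a::ab_group_add"
  assumes "finite {x. g x \<noteq> 0}"
  shows "Sum_any (\<lambda>x. g (x - 1) - g x) = 0"
proof -
  have b: "bij (\<lambda>x::complex. x - 1)" by (rule o_bij [of "\<lambda>x. x + 1"]) auto
  have "{x. g (x - 1) \<noteq> 0} = (\<lambda>x. x + 1) ` {x. g x \<noteq> 0}"
    by (auto simp: image_iff) (metis diff_add_cancel)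
  then have "finite {x. g (x - 1) \<noteq> 0}" using assms by simp
  then show ?thesis
    using assms Sum_any_reindex_bij[OF b, of g] by (simp add: Sum_any_diff)
qed

lemma Sum_any_hom:
  assumes "finite {x. g x \<noteq> 0}" "f 0 = 0" "\<And>x y. f (x + y) = f x + f y"
  shows "f (Sum_any g) = Sum_any (\<lambda>x. f (g x))"
proof -
  have "f (sum g A) = (\<Sum>x\<in>A. f (g x))" if "finite A" for A
    using that by induction (simp_all add: assms)
  moreover have "Sum_any (\<lambda>x. f (g x)) = (\<Sum>x | g x \<noteq> 0. f (g x))"
    using assms by (intro Sum_any.expand_superset) auto
  ultimately show ?thesis using assms(1) by (simp add: Sum_any.expand_set [of g])
qed

lemma Sum_any_sum_swap:
  assumes "finite A" "\<And>j. j \<in> A \<Longrightarrow> finite {x. f j x \<noteq> 0}"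
  shows "(\<Sum>j\<in>A. Sum_any (f j)) = Sum_any (\<lambda>x. \<Sum>j\<in>A. f j x)"
  using assms
proof (induction A)
  case (insert j A)
  have "{x. (\<Sum>j\<in>A. f j x) \<noteq> 0} \<subseteq> (\<Union>j\<in>A. {x. f j x \<noteq> 0})"
    by (auto elim!: sum.not_neutral_contains_not_neutral)
  then have "finite {x. (\<Sum>j\<in>A. f j x) \<noteq> 0}"
    using insert by (auto intro: finite_subset)
  with insert show ?case by (simp add: Sum_any.distrib)
qed simp

lemma finite_support_Suc:
  assumes "finite {i. f i \<noteq> (0 :: 'a::zero)}"
  shows "finite {i. f (Suc i) \<noteq> 0}"
  using finite_vimageI [OF assms, of Suc] by simp

lemma Sum_any_Suc:
  fixes f :: "nat \<Rightarrow> 'a::ab_group_add"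
  assumes "finite {i. f i \<noteq> 0}"
  shows "Sum_any f = f 0 + Sum_any (\<lambda>i. f (Suc i))"
proof -
  have fin: "finite {i. f (Suc i) \<noteq> 0}" using assms by (rule finite_support_Suc)
  let ?B = "{i. f (Suc i) \<noteq> 0}"
  have "{i. f i \<noteq> 0} \<subseteq> insert 0 (Suc ` ?B)"
    by (auto simp: image_iff) (metis not0_implies_Suc)
  then have "Sum_any f = sum f (insert 0 (Suc ` ?B))"
    using fin by (intro Sum_any.expand_superset) auto
  also have "\<dots> = f 0 + sum f (Suc ` ?B)" using fin by (subst sum.insert) auto
  also have "sum f (Suc ` ?B) = Sum_any (\<lambda>i. f (Suc i))"
    by (simp add: sum.reindex Sum_any.expand_set)
  finally show ?thesis .
qed

lemma Sum_any_split:
  assumes inj: "inj h1" "inj h2" and disj: "range h1 \<inter> range h2 = {}"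
    and fin: "finite {x. f x \<noteq> 0}" and sub: "{x. f x \<noteq> 0} \<subseteq> range h1 \<union> range h2"
  shows "Sum_any f = Sum_any (\<lambda>i. f (h1 i)) + Sum_any (\<lambda>j. f (h2 j))"
proof -
  have fin1: "finite {i. f (h1 i) \<noteq> 0}" and fin2: "finite {j. f (h2 j) \<noteq> 0}"
    using finite_vimageI [OF fin inj(1)] finite_vimageI [OF fin inj(2)] by simp_all
  let ?A = "h1 ` {i. f (h1 i) \<noteq> 0}" and ?B = "h2 ` {j. f (h2 j) \<noteq> 0}"
  have "Sum_any f = sum f (?A \<union> ?B)"
    using fin1 fin2 sub by (intro Sum_any.expand_superset) auto
  also have "\<dots> = sum f ?A + sum f ?B"
    using fin1 fin2 disj by (intro sum.union_disjoint) auto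
  also have "sum f ?A = Sum_any (\<lambda>i. f (h1 i))"
    using inj(1) by (simp add: sum.reindex inj_on_def Sum_any.expand_set)
  also have "sum f ?B = Sum_any (\<lambda>j. f (h2 j))"
    using inj(2) by (simp add: sum.reindex inj_on_def Sum_any.expand_set)
  finally show ?thesis .
qed

section \<open>Supports bounded below\<close>

text \<open>
  Exponents of a logarithmic field applied to one vector lie in finitely many cosets of \<open>\<int>\<close> and are
  bounded below in each of them, that is, in \<open>cone S\<close> for a finite \<open>S\<close>.
\<close>
definition cone :: "complex set \<Rightarrow> complex set" where
  "cone S = {s + of_nat i | s i. s \<in> S}"

lemma cone_Suc:
  assumes "\<gamma> - 1 \<in> cone S"
  shows "\<gamma> \<in> cone S"
proof -
  obtain s i where "s \<in> S" "\<gamma> - 1 = s + of_nat i" using assms unfolding cone_def by blast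
  then have "\<gamma> = s + of_nat (Suc i)" by (simp add: diff_eq_eq)
  with \<open>s \<in> S\<close> show ?thesis unfolding cone_def by blast
qed

lemma cone_pred:
  assumes "\<gamma> + 1 \<in> cone S"
  shows "\<gamma> \<in> cone ((\<lambda>s. s - 1) ` S)"
proof -
  obtain s i where "s \<in> S" "\<gamma> + 1 = s + of_nat i" using assms unfolding cone_def by blast
  then have "\<gamma> = (s - 1) + of_nat i" by (simp add: diff_add_eq eq_diff_eq)
  with \<open>s \<in> S\<close> show ?thesis unfolding cone_def by blast
qed

lemma finite_cone_down:
  assumes "finite S"
  shows "finite {i::nat. \<gamma> - of_nat i \<in> cone S}"
proof -
  have "finite {i::nat. \<exists>j::nat. \<gamma> - of_nat i = s + of_nat j}" for s :: complex
  proof (cases "\<exists>p::nat. \<gamma> - s = of_nat p")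
    case True
    then obtain p :: nat where p: "\<gamma> - s = of_nat p" by blast
    have "{i::nat. \<exists>j::nat. \<gamma> - of_nat i = s + of_nat j} \<subseteq> {..p}"
    proof
      fix i assume "i \<in> {i::nat. \<exists>j::nat. \<gamma> - of_nat i = s + of_nat j}"
      then obtain j :: nat where "\<gamma> - of_nat i = s + of_nat j" by blast
      with p have "of_nat p = (of_nat (i + j) :: complex)" by (simp add: algebra_simps)
      then show "i \<in> {..p}" by (simp only: of_nat_eq_iff) simp
    qed
    then show ?thesis by (rule finite_subset) simp
  next
    case False
    have "{i::nat. \<exists>j::nat. \<gamma> - of_nat i = s + of_nat j} = {}"
    proof -
      have "\<gamma> - of_nat i \<noteq> s + of_nat j" for i j :: nat
      proof
        assume "\<gamma> - of_nat i = s + of_nat j"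
        then have "\<gamma> - s = of_nat (i + j)" by (simp add: algebra_simps)
        with False show False by blast
      qed
      then show ?thesis by blast
    qed
    then show ?thesis by (simp only: finite.emptyI)
  qed
  then have "finite (\<Union>s\<in>S. {i::nat. \<exists>j::nat. \<gamma> - of_nat i = s + of_nat j})"
    using assms by blast
  then show ?thesis
    by (rule rev_finite_subset) (auto simp: cone_def)
qed

text \<open>
  This is what makes the restriction of a series in two variables to the diagonal a finite sum in each
  degree.
\<close>
lemma finite_cone_antidiagonal:
  assumes "finite S" "finite T"
  shows "finite {\<gamma>1. \<gamma>1 \<in> cone S \<and> \<gamma> - \<gamma>1 \<in> cone T}"
proof -
  have "{\<gamma>1. \<gamma>1 \<in> cone S \<and> \<gamma> - \<gamma>1 \<in> cone T} \<subseteq>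
     (\<Union>s\<in>S. (\<lambda>i. s + of_nat i) ` {i. (\<gamma> - s) - of_nat i \<in> cone T})"
    by (auto simp: cone_def [of S] diff_diff_eq)
  moreover have "finite (\<Union>s\<in>S. (\<lambda>i. s + of_nat i) ` {i::nat. (\<gamma> - s) - of_nat i \<in> cone T})"
    using assms by (intro finite_UN_I finite_imageI finite_cone_down)
  ultimately show ?thesis by (rule finite_subset)
qed

definition supported_in :: "complex set \<Rightarrow> complex set \<Rightarrow> 'w::zero series2 \<Rightarrow> bool" where
  "supported_in S T F \<longleftrightarrow> (\<forall>\<gamma>1 l1 \<gamma>2 l2. F \<gamma>1 l1 \<gamma>2 l2 \<noteq> 0 \<longrightarrow> \<gamma>1 \<in> S \<and> \<gamma>2 \<in> T)"

lemma supported_in_mult_z12: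
  assumes "supported_in S T F" "\<And>\<gamma>. \<gamma> - 1 \<in> S \<Longrightarrow> \<gamma> \<in> S" "\<And>\<gamma>. \<gamma> - 1 \<in> T \<Longrightarrow> \<gamma> \<in> T"
  shows "supported_in S T (mult_z12 F)"
  unfolding supported_in_def mult_z12_def
proof (intro allI impI)
  fix \<gamma>1 l1 \<gamma>2 l2
  assume "F (\<gamma>1 - 1) l1 \<gamma>2 l2 - F \<gamma>1 l1 (\<gamma>2 - 1) l2 \<noteq> 0"
  then have "F (\<gamma>1 - 1) l1 \<gamma>2 l2 \<noteq> 0 \<or> F \<gamma>1 l1 (\<gamma>2 - 1) l2 \<noteq> 0" by auto
  then show "\<gamma>1 \<in> S \<and> \<gamma>2 \<in> T" using assms unfolding supported_in_def by blast
qed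

lemma supported_in_mult_z12_funpow:
  assumes "supported_in S T F" "\<And>\<gamma>. \<gamma> - 1 \<in> S \<Longrightarrow> \<gamma> \<in> S" "\<And>\<gamma>. \<gamma> - 1 \<in> T \<Longrightarrow> \<gamma> \<in> T"
  shows "supported_in S T ((mult_z12 ^^ N) F)"
  using assms by (induction N) (auto intro: supported_in_mult_z12)

definition cone_supported :: "'w::zero series2 \<Rightarrow> bool" where
  "cone_supported F \<longleftrightarrow> (\<exists>S T. finite S \<and> finite T \<and> supported_in (cone S) (cone T) F)"

lemma cone_supported_mult_z12: "cone_supported F \<Longrightarrow> cone_supported (mult_z12 F)"
  unfolding cone_supported_def by (meson supported_in_mult_z12 cone_Suc)

lemma cone_supported_finite:
  assumes "cone_supported F"
  shows "finite {\<gamma>1. \<exists>l1 l2. F \<gamma>1 l1 (\<gamma> - \<gamma>1) l2 \<noteq> 0}"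
proof -
  obtain S T where "finite S" "finite T" and ST: "supported_in (cone S) (cone T) F"
    using assms unfolding cone_supported_def by blast
  then have "finite {\<gamma>1. \<gamma>1 \<in> cone S \<and> \<gamma> - \<gamma>1 \<in> cone T}" by (intro finite_cone_antidiagonal)
  then show ?thesis
    by (rule rev_finite_subset) (use ST in \<open>auto simp: supported_in_def\<close>)
qed

text \<open>
  Multiplication by \<open>z12\<close> acts on the exponents of \<open>z1\<close> and \<open>z2\<close> only. A relation between
  coefficients that holds at fixed powers of the logarithms, for all exponents of \<open>z1\<close> and \<open>z2\<close>,
  therefore survives it.
\<close>
lemma mult_z12_funpow_pointwise:
  fixes F G :: "'w::ab_group_add series2"
  assumes h0: "\<And>x y. h (x - y) = h x - h y" and h1: "\<And>x y. h' (x - y) = h' x - h' y"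
    and "\<And>\<gamma>1 \<gamma>2. h (F \<gamma>1 l1 \<gamma>2 l2) = h' (G \<gamma>1 l1' \<gamma>2 l2)"
  shows "h ((mult_z12 ^^ M) F \<gamma>1 l1 \<gamma>2 l2) = h' ((mult_z12 ^^ M) G \<gamma>1 l1' \<gamma>2 l2)"
  using assms(3) by (induction M arbitrary: \<gamma>1 \<gamma>2) (simp_all add: mult_z12_def h0 h1)

lemma mult_z12_funpow_add:
  "(mult_z12 ^^ M) (\<lambda>\<gamma>1 l1 \<gamma>2 l2. F \<gamma>1 l1 \<gamma>2 l2 + G \<gamma>1 l1 \<gamma>2 l2) \<gamma>1 l1 \<gamma>2 l2 =
    (mult_z12 ^^ M) F \<gamma>1 l1 \<gamma>2 l2 + (mult_z12 ^^ M) G \<gamma>1 l1 \<gamma>2 l2"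
  by (induction M arbitrary: \<gamma>1 l1 \<gamma>2 l2) (simp_all add: mult_z12_def)

section \<open>Series in two variables and their restriction to the diagonal\<close>

text \<open>
  On the diagonal, \<open>z12\<close> vanishes; in coefficients the sum telescopes, which needs it to be finite.
\<close>
lemma diag_mult_z12:
  assumes "cone_supported F"
  shows "diag (mult_z12 F) = (\<lambda>\<gamma> l. 0)"
proof (intro ext)
  fix \<gamma> l
  define g where "g = (\<lambda>\<gamma>1. \<Sum>l1\<le>l. F \<gamma>1 l1 (\<gamma> - 1 - \<gamma>1) (l - l1))"
  have "{\<gamma>1. g \<gamma>1 \<noteq> 0} \<subseteq> {\<gamma>1. \<exists>l1 l2. F \<gamma>1 l1 (\<gamma> - 1 - \<gamma>1) l2 \<noteq> 0}"
    unfolding g_def by (auto elim!: sum.not_neutral_contains_not_neutral)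
  then have "finite {\<gamma>1. g \<gamma>1 \<noteq> 0}"
    using cone_supported_finite[OF assms] by (rule finite_subset)
  then have "Sum_any (\<lambda>\<gamma>1. g (\<gamma>1 - 1) - g \<gamma>1) = 0" by (rule Sum_any_shift_diff)
  moreover have "diag (mult_z12 F) \<gamma> l = Sum_any (\<lambda>\<gamma>1. g (\<gamma>1 - 1) - g \<gamma>1)"
    unfolding diag_def mult_z12_def g_def
    by (rule arg_cong[where f = Sum_any]) (simp add: sum_subtractf algebra_simps)
  ultimately show "diag (mult_z12 F) \<gamma> l = 0" by simp
qed

lemma local_with_mono:
  fixes a b :: "'w::ab_group_add lfield"
  assumes "local_with N a b" "N \<le> M"
  shows "local_with M a b"
proof -
  have "mult_z12 ^^ M = (mult_z12 ^^ (M - N)) \<circ> (mult_z12 ^^ N :: 'w series2 \<Rightarrow> _)"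
    using assms(2) by (simp add: funpow_add [symmetric])
  then show ?thesis using assms(1) by (simp add: local_with_def)
qed

text \<open>
  Scalars are complex numbers because the exponents of \<open>z1\<close> act as scalars when a series is
  differentiated.
\<close>
locale complex_vector_space = vector_space scale
  for scale :: "complex \<Rightarrow> 'w::ab_group_add \<Rightarrow> 'w"
begin

lemma cone_supported_D_z1:
  assumes "cone_supported F"
  shows "cone_supported (D_z1 scale F)"
proof -
  obtain S T where fin: "finite S" "finite T" and ST: "supported_in (cone S) (cone T) F"
    using assms unfolding cone_supported_def by blast
  have "supported_in (cone ((\<lambda>s. s - 1) ` S)) (cone T) (D_z1 scale F)"
    unfolding supported_in_def D_z1_def
  proof (intro allI impI)
    fix \<gamma>1 l1 \<gamma>2 l2
    assume "scale (\<gamma>1 + 1) (F (\<gamma>1 + 1) l1 \<gamma>2 l2) +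
      scale (of_nat (l1 + 1)) (F (\<gamma>1 + 1) (l1 + 1) \<gamma>2 l2) \<noteq> 0"
    then have "F (\<gamma>1 + 1) l1 \<gamma>2 l2 \<noteq> 0 \<or> F (\<gamma>1 + 1) (l1 + 1) \<gamma>2 l2 \<noteq> 0" by auto
    then show "\<gamma>1 \<in> cone ((\<lambda>s. s - 1) ` S) \<and> \<gamma>2 \<in> cone T"
      using ST cone_pred unfolding supported_in_def by blast
  qed
  then show ?thesis using fin unfolding cone_supported_def by blast
qed

lemma cone_supported_D_z1_funpow:
  "cone_supported F \<Longrightarrow> cone_supported ((D_z1 scale ^^ j) F)"
  by (induction j) (auto intro: cone_supported_D_z1)

text \<open>
  The Leibniz rule: \<open>z12\<close> is free of logarithms and has derivative 1 with respect to \<open>z1\<close>.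
\<close>
lemma D_z1_mult_z12: "D_z1 scale (mult_z12 F) = (\<lambda>\<gamma>1 l1 \<gamma>2 l2.
    mult_z12 (D_z1 scale F) \<gamma>1 l1 \<gamma>2 l2 + F \<gamma>1 l1 \<gamma>2 l2)"
  by (intro ext) (simp add: D_z1_def mult_z12_def algebra_simps)

lemma D_z1_add_scale: "D_z1 scale (\<lambda>\<gamma>1 l1 \<gamma>2 l2. F \<gamma>1 l1 \<gamma>2 l2 + scale c (G \<gamma>1 l1 \<gamma>2 l2)) =
    (\<lambda>\<gamma>1 l1 \<gamma>2 l2. D_z1 scale F \<gamma>1 l1 \<gamma>2 l2 + scale c (D_z1 scale G \<gamma>1 l1 \<gamma>2 l2))"
  by (intro ext) (simp add: D_z1_def scale_right_distrib mult.commute)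

lemma scale_of_nat_Suc: "scale (of_nat (Suc n)) x = x + scale (of_nat n) x"
  by (simp add: scale_left_distrib)

lemma D_z1_funpow_mult_z12: "(D_z1 scale ^^ j) (mult_z12 F) = (\<lambda>\<gamma>1 l1 \<gamma>2 l2.
    mult_z12 ((D_z1 scale ^^ j) F) \<gamma>1 l1 \<gamma>2 l2 +
    scale (of_nat j) ((D_z1 scale ^^ (j - 1)) F \<gamma>1 l1 \<gamma>2 l2))"
proof (induction j)
  case (Suc j)
  have "(D_z1 scale ^^ Suc j) (mult_z12 F) = (\<lambda>\<gamma>1 l1 \<gamma>2 l2.
      D_z1 scale (mult_z12 ((D_z1 scale ^^ j) F)) \<gamma>1 l1 \<gamma>2 l2 +
      scale (of_nat j) (D_z1 scale ((D_z1 scale ^^ (j - 1)) F) \<gamma>1 l1 \<gamma>2 l2))"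
    unfolding funpow.simps comp_apply Suc D_z1_add_scale ..
  then show ?case
    by (cases j) (simp_all add: D_z1_mult_z12 scale_of_nat_Suc add_ac
        del: of_nat_Suc)
qed simp

lemma finite_diag_support:
  assumes "cone_supported F"
  shows "finite {\<gamma>1. (\<Sum>l1\<le>l. F \<gamma>1 l1 (\<gamma> - \<gamma>1) (l - l1)) \<noteq> 0}"
  by (rule finite_subset [OF _ cone_supported_finite [OF assms, of \<gamma>]])
    (auto elim!: sum.not_neutral_contains_not_neutral)

lemma diag_add_scale:
  assumes "cone_supported F" "cone_supported G"
  shows "diag (\<lambda>\<gamma>1 l1 \<gamma>2 l2. F \<gamma>1 l1 \<gamma>2 l2 + scale c (G \<gamma>1 l1 \<gamma>2 l2)) =
    (\<lambda>\<gamma> l. diag F \<gamma> l + scale c (diag G \<gamma> l))"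
proof (intro ext)
  fix \<gamma> l
  note fin = finite_diag_support [OF assms(1), where l = l and \<gamma> = \<gamma>]
    finite_diag_support [OF assms(2), where l = l and \<gamma> = \<gamma>]
  have "finite {\<gamma>1. scale c (\<Sum>l1\<le>l. G \<gamma>1 l1 (\<gamma> - \<gamma>1) (l - l1)) \<noteq> 0}"
    by (rule finite_subset [OF _ fin(2)]) force
  with fin show "diag (\<lambda>\<gamma>1 l1 \<gamma>2 l2. F \<gamma>1 l1 \<gamma>2 l2 + scale c (G \<gamma>1 l1 \<gamma>2 l2)) \<gamma> l =
      diag F \<gamma> l + scale c (diag G \<gamma> l)"
    by (simp add: diag_def sum.distrib scale_sum_right [symmetric] Sum_any.distrib
        Sum_any_hom [where f = "scale c"] scale_right_distrib)
qed

lemma diag_scale: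
  assumes "cone_supported F"
  shows "diag (\<lambda>\<gamma>1 l1 \<gamma>2 l2. scale c (F \<gamma>1 l1 \<gamma>2 l2)) = (\<lambda>\<gamma> l. scale c (diag F \<gamma> l))"
proof -
  have "cone_supported (\<lambda>\<gamma>1 l1 \<gamma>2 l2. 0)"
    unfolding cone_supported_def supported_in_def by blast
  from diag_add_scale [OF this assms, of c] show ?thesis by (simp add: diag_def)
qed

section \<open>The products of local fields\<close>

text \<open>
  Multiplying by one more factor \<open>z12\<close> and differentiating once more changes nothing on the
  diagonal: all terms of the Leibniz expansion but one still carry the factor \<open>z12\<close>.
\<close>
lemma diag_D_z1_mult_z12:
  assumes "cone_supported F"
  shows "diag ((D_z1 scale ^^ Suc j) (mult_z12 F)) =
    (\<lambda>\<gamma> l. scale (of_nat (Suc j)) (diag ((D_z1 scale ^^ j) F) \<gamma> l))"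
  unfolding D_z1_funpow_mult_z12
  by (subst diag_add_scale)
    (simp_all add: assms cone_supported_mult_z12 cone_supported_D_z1_funpow diag_mult_z12
      cone_supported_D_z1 del: of_nat_Suc)

lemma field_prd_with_eq:
  assumes "cone_supported ((mult_z12 ^^ N) (prod12 a b v))"
  shows "field_prd_with scale N n a b v = (if n \<le> int N - 1
    then (\<lambda>\<gamma> l. scale (1 / fact (nat (int N - 1 - n)))
      (diag ((D_z1 scale ^^ nat (int N - 1 - n)) ((mult_z12 ^^ N) (prod12 a b v))) \<gamma> l))
    else (\<lambda>\<gamma> l. 0))"
  by (simp add: field_prd_with_def Let_def diag_scale cone_supported_D_z1_funpow assms)

text \<open>
  Raising the locality exponent by one multiplies the series by \<open>z12\<close> and raises the order of the
  derivative by one, which cancels on the diagonal up to the factor accounted for by the factorials.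
  For \<open>n = N\<close> the product computed with exponent \<open>N + 1\<close> involves no derivative and vanishes on the
  diagonal, as it should.
\<close>
lemma field_prd_with_Suc:
  assumes "cone_supported ((mult_z12 ^^ N) (prod12 a b v))"
  shows "field_prd_with scale (Suc N) n a b v = field_prd_with scale N n a b v"
proof -
  let ?F = "(mult_z12 ^^ N) (prod12 a b v)"
  have Suc: "cone_supported ((mult_z12 ^^ Suc N) (prod12 a b v))"
    using cone_supported_mult_z12 [OF assms] by simp
  consider "n \<le> int N - 1" | "n = int N" | "n > int N" by linarith
  then show ?thesis
  proof cases
    case 1
    then have "nat (int (Suc N) - 1 - n) = Suc (nat (int N - 1 - n))" by simp
    with 1 show ?thesis
      unfolding field_prd_with_eq [OF assms] field_prd_with_eq [OF Suc]
      using diag_D_z1_mult_z12 [OF assms, of "nat (int N - 1 - n)"]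
      by (simp del: funpow.simps of_nat_Suc add: funpow.simps(2) [of N])
  next
    case 2
    then show ?thesis
      unfolding field_prd_with_eq [OF assms] field_prd_with_eq [OF Suc]
      by (simp add: diag_mult_z12 assms)
  next
    case 3
    then show ?thesis
      unfolding field_prd_with_eq [OF assms] field_prd_with_eq [OF Suc] by simp
  qed
qed

lemma LFie_linear:
  assumes "a \<in> LFie scale"
  shows "Vector_Spaces.linear scale scale (\<lambda>v. a v \<gamma> l)"
proof -
  obtain A c where A: "finite A" "\<forall>\<alpha>\<in>A. c \<alpha> \<in> LFie_comp scale \<alpha>"
    and a: "a = (\<lambda>v \<gamma> l. \<Sum>\<alpha>\<in>A. c \<alpha> v \<gamma> l)"
    using assms unfolding LFie_def by blast
  have lin: "Vector_Spaces.linear scale scale (\<lambda>v. c \<alpha> v \<gamma> l)" if "\<alpha> \<in> A" for \<alpha>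
    using A(2) that unfolding LFie_comp_def by blast
  have "c \<alpha> (x + y) \<gamma> l = c \<alpha> x \<gamma> l + c \<alpha> y \<gamma> l"
    and "c \<alpha> (scale r x) \<gamma> l = scale r (c \<alpha> x \<gamma> l)" if "\<alpha> \<in> A" for \<alpha> x y r
    using lin [OF that] by (simp_all add: module_hom_iff_linear [symmetric] module_hom_iff)
  then show ?thesis
    unfolding a module_hom_iff_linear [symmetric]
    by (simp add: module_hom_iff module_axioms sum.distrib scale_sum_right)
qed

lemma LFie_support:
  assumes "a \<in> LFie scale"
  obtains S where "finite S" "\<And>\<gamma> l. a v \<gamma> l \<noteq> 0 \<Longrightarrow> \<gamma> \<in> cone S"
proof -
  obtain A c where A: "finite A" "\<forall>\<alpha>\<in>A. c \<alpha> \<in> LFie_comp scale \<alpha>"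
    and a: "a = (\<lambda>v \<gamma> l. \<Sum>\<alpha>\<in>A. c \<alpha> v \<gamma> l)"
    using assms unfolding LFie_def by blast
  have "\<forall>\<alpha>\<in>A. \<exists>m. \<forall>\<gamma> l. c \<alpha> v \<gamma> l \<noteq> 0 \<longrightarrow> (\<exists>i::nat. \<gamma> = of_nat i - m)"
    using A(2) unfolding LFie_comp_def log_series_def by blast
  then obtain m where
    m: "\<And>\<alpha> \<gamma> l. \<alpha> \<in> A \<Longrightarrow> c \<alpha> v \<gamma> l \<noteq> 0 \<Longrightarrow> \<exists>i::nat. \<gamma> = of_nat i - m \<alpha>"
    by metis
  show ?thesis
  proof (rule that [of "(\<lambda>\<alpha>. - m \<alpha>) ` A"])
    show "\<gamma> \<in> cone ((\<lambda>\<alpha>. - m \<alpha>) ` A)" if nz: "a v \<gamma> l \<noteq> 0" for \<gamma> l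
    proof -
      obtain \<alpha> where "\<alpha> \<in> A" "c \<alpha> v \<gamma> l \<noteq> 0"
        using nz unfolding a by (auto elim: sum.not_neutral_contains_not_neutral)
      with m obtain i :: nat where "\<gamma> = - m \<alpha> + of_nat i" by force
      with \<open>\<alpha> \<in> A\<close> show ?thesis unfolding cone_def by blast
    qed
  qed (use A in simp)
qed

lemma LFie_finite_log_degree:
  assumes "a \<in> LFie scale"
  shows "finite {l. a v \<gamma> l \<noteq> 0}"
proof -
  obtain A c where A: "finite A" "\<forall>\<alpha>\<in>A. c \<alpha> \<in> LFie_comp scale \<alpha>"
    and a: "a = (\<lambda>v \<gamma> l. \<Sum>\<alpha>\<in>A. c \<alpha> v \<gamma> l)"
    using assms unfolding LFie_def by blast
  then have "finite (\<Union>\<alpha>\<in>A. {l. c \<alpha> v \<gamma> l \<noteq> 0})"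
    unfolding LFie_comp_def log_series_def by blast
  then show ?thesis
    by (rule rev_finite_subset) (auto simp: a elim: sum.not_neutral_contains_not_neutral)
qed

lemma prod12_support:
  assumes "a \<in> LFie scale" "\<And>\<gamma> l. b v \<gamma> l \<noteq> 0 \<Longrightarrow> \<gamma> \<in> T"
  shows "supported_in UNIV T (prod12 a b v)"
  unfolding supported_in_def prod12_def
proof (intro allI impI conjI)
  fix \<gamma>1 l1 \<gamma>2 l2 assume nz: "a (b v \<gamma>2 l2) \<gamma>1 l1 \<noteq> 0"
  have "a 0 \<gamma>1 l1 = 0"
    using LFie_linear [OF assms(1)] unfolding module_hom_iff_linear [symmetric]
    by (rule module_hom.zero)
  with nz have "b v \<gamma>2 l2 \<noteq> 0" by metis
  then show "\<gamma>2 \<in> T" by (rule assms(2))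
qed simp

lemma prod21_support:
  assumes "b \<in> LFie scale" "\<And>\<gamma> l. a v \<gamma> l \<noteq> 0 \<Longrightarrow> \<gamma> \<in> S"
  shows "supported_in S UNIV (prod21 a b v)"
proof -
  have "supported_in UNIV S (prod12 b a v)" using assms by (rule prod12_support)
  then show ?thesis unfolding supported_in_def prod12_def prod21_def by blast
qed

text \<open>
  The product \<open>a(z1) b(z2) v\<close> is bounded below in \<open>z2\<close> only, and \<open>b(z2) a(z1) v\<close> in \<open>z1\<close> only. By
  locality, the series considered here is a multiple of both.
\<close>
lemma local_product_cone_supported:
  assumes a: "a \<in> LFie scale" and b: "b \<in> LFie scale" and loc: "local_with N a b"
  shows "cone_supported ((mult_z12 ^^ N) (prod12 a b v))"
proof -
  obtain S T where S: "finite S" "\<And>\<gamma> l. a v \<gamma> l \<noteq> 0 \<Longrightarrow> \<gamma> \<in> cone S"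
    and T: "finite T" "\<And>\<gamma> l. b v \<gamma> l \<noteq> 0 \<Longrightarrow> \<gamma> \<in> cone T"
    using LFie_support [OF a, of v] LFie_support [OF b, of v] by metis
  have "supported_in UNIV (cone T) ((mult_z12 ^^ N) (prod12 a b v))"
    by (rule supported_in_mult_z12_funpow [OF prod12_support [OF a T(2)]]) (auto intro: cone_Suc)
  moreover have "supported_in (cone S) UNIV ((mult_z12 ^^ N) (prod21 a b v))"
    by (rule supported_in_mult_z12_funpow [OF prod21_support [OF b S(2)]]) (auto intro: cone_Suc)
  then have "supported_in (cone S) UNIV ((mult_z12 ^^ N) (prod12 a b v))"
    using loc unfolding local_with_def by simp
  ultimately have "supported_in (cone S) (cone T) ((mult_z12 ^^ N) (prod12 a b v))"
    unfolding supported_in_def by blast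
  with S(1) T(1) show ?thesis unfolding cone_supported_def by blast
qed

text \<open>
  The products can thus be computed with any exponent that witnesses locality, in particular with one
  that is common to several pairs of fields.
\<close>
lemma field_prd_eq_with:
  assumes a: "a \<in> LFie scale" and b: "b \<in> LFie scale" and loc: "local_with N a b"
  shows "field_prd scale n a b = field_prd_with scale N n a b"
proof -
  let ?L = "LEAST N. local_with N a b"
  have L: "local_with ?L a b" using loc by (rule LeastI)
  have "local_with (?L + i) a b \<and>
      field_prd_with scale (?L + i) n a b = field_prd_with scale ?L n a b" for i
  proof (induction i)
    case (Suc i)
    then have "local_with (Suc (?L + i)) a b" unfolding local_with_def by simp
    moreover have "field_prd_with scale (Suc (?L + i)) n a b = field_prd_with scale (?L + i) n a b"
      using Suc by (intro ext) (simp add: field_prd_with_Suc local_product_cone_supported a b)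
    ultimately show ?case using Suc by simp
  qed (simp add: L)
  from this [of "N - ?L"] show ?thesis
    using Least_le [of "\<lambda>N. local_with N a b", OF loc] by (simp add: field_prd_def)
qed

end

section \<open>Residues of the two expansions of a power of \<open>z12\<close>\<close>

lemma gbinomial_neg_Suc:
  "(- 1 - of_nat J :: complex) gchoose i = (- 1) ^ i * of_nat (J + i choose J)"
proof -
  have "(- 1 - of_nat J :: complex) gchoose i = (- 1) ^ i * (of_nat (J + i) gchoose i)"
    by (subst gbinomial_negated_upper) (simp add: algebra_simps)
  also have "(of_nat (J + i) gchoose i :: complex) = of_nat (J + i choose J)"
    by (simp only: binomial_gbinomial [symmetric]) (simp add: binomial_symmetric [of i "J + i"])
  finally show ?thesis .
qed

lemma minus_one_powi_add: "(- 1 :: complex) powi (n + int i) = (- 1) powi n * (- 1) ^ i"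
  by (simp add: power_int_add)

lemma minus_one_powi_neg_Suc: "(- 1 :: complex) powi (- 1 - int J) = - ((- 1) ^ J)"
proof -
  have "(- 1 :: complex) powi (- 1 - int J) = (- 1) powi (- int (Suc J))" by simp
  also have "\<dots> = inverse ((- 1) ^ Suc J)" by (simp only: power_int_minus power_int_of_nat)
  also have "\<dots> = (- 1) ^ Suc J" by (simp add: power_inverse [symmetric])
  finally show ?thesis by simp
qed

context complex_vector_space
begin

text \<open>
  The residue in \<open>z1\<close> and \<open>z2\<close> of $z_1^m z_2^k z_{12}^n F$ at $\zeta_1=\zeta_2=0$, where $z_{12}^n$ is
  expanded in nonnegative powers of \<open>z2\<close>. It makes sense for \<open>F\<close> bounded below in \<open>z2\<close>.
\<close>
definition res12 :: "int \<Rightarrow> complex \<Rightarrow> complex \<Rightarrow> 'w series2 \<Rightarrow> 'w" where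
  "res12 n m k F = Sum_any (\<lambda>i::nat. scale ((-1) ^ i * (of_int n gchoose i))
     (F (- 1 - (m + of_int n - of_nat i)) 0 (- 1 - (k + of_nat i)) 0))"

text \<open>
  The same residue with $z_{12}^n$ expanded in nonnegative powers of \<open>z1\<close>, for \<open>F\<close> bounded below in \<open>z1\<close>.
\<close>
definition res21 :: "int \<Rightarrow> complex \<Rightarrow> complex \<Rightarrow> 'w series2 \<Rightarrow> 'w" where
  "res21 n m k F = Sum_any (\<lambda>i::nat. scale ((-1) powi (n + int i) * (of_int n gchoose i))
     (F (- 1 - (m + of_nat i)) 0 (- 1 - (k + of_int n - of_nat i)) 0))"

lemma finite_res12:
  assumes "supported_in UNIV (cone T) F" "finite T"
  shows "finite {i::nat. F (g i) 0 (- 1 - (k + of_nat i)) 0 \<noteq> 0}"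
proof -
  have "{i::nat. F (g i) 0 (- 1 - (k + of_nat i)) 0 \<noteq> 0} \<subseteq> {i. (- 1 - k) - of_nat i \<in> cone T}"
    using assms(1) unfolding supported_in_def diff_diff_eq by blast
  then show ?thesis using finite_cone_down [OF assms(2)] by (rule finite_subset)
qed

lemma finite_res21:
  assumes "supported_in (cone S) UNIV F" "finite S"
  shows "finite {i::nat. F (- 1 - (m + of_nat i)) 0 (g i) 0 \<noteq> 0}"
proof -
  have "{i::nat. F (- 1 - (m + of_nat i)) 0 (g i) 0 \<noteq> 0} \<subseteq> {i. (- 1 - m) - of_nat i \<in> cone S}"
    using assms(1) unfolding supported_in_def diff_diff_eq by blast
  then show ?thesis using finite_cone_down [OF assms(2)] by (rule finite_subset)
qed

lemma finite_scale_support: "finite {i. f i \<noteq> 0} \<Longrightarrow> finite {i. scale (c i) (f i) \<noteq> 0}"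
  by (rule finite_subset [of _ "{i. f i \<noteq> 0}"]) auto

text \<open>
  Summation by parts: the Pascal rule moves one difference operator from the sequence to the binomial
  coefficients. Up to the index shift, this is multiplication by \<open>z12\<close> in either expansion.
\<close>
lemma alternating_sum_Pascal:
  assumes fin: "finite {i. f i \<noteq> 0}"
  shows "Sum_any (\<lambda>i. scale ((-1) ^ i * ((x + 1) gchoose i)) (f i)) =
    Sum_any (\<lambda>i. scale ((-1) ^ i * (x gchoose i)) (f i - f (Suc i)))"
proof -
  have fin': "finite {i. f (Suc i) \<noteq> 0}" using fin by (rule finite_support_Suc)
  note fins = finite_scale_support [OF fin] finite_scale_support [OF fin']
  have "Sum_any (\<lambda>i. scale ((-1) ^ i * ((x + 1) gchoose i)) (f i)) =
      f 0 + Sum_any (\<lambda>i. scale ((-1) ^ Suc i * (x gchoose Suc i)) (f (Suc i))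
        - scale ((-1) ^ i * (x gchoose i)) (f (Suc i)))"
    by (subst Sum_any_Suc [OF fins(1)])
      (simp add: gbinomial_Suc_Suc distrib_left scale_left_distrib scale_left_diff_distrib
        minus_diff_commute)
  also have "\<dots> = (f 0 + Sum_any (\<lambda>i. scale ((-1) ^ Suc i * (x gchoose Suc i)) (f (Suc i))))
        - Sum_any (\<lambda>i. scale ((-1) ^ i * (x gchoose i)) (f (Suc i)))"
    by (subst Sum_any_diff [OF fins(2) fins(2)]) simp
  also have "f 0 + Sum_any (\<lambda>i. scale ((-1) ^ Suc i * (x gchoose Suc i)) (f (Suc i))) =
      Sum_any (\<lambda>i. scale ((-1) ^ i * (x gchoose i)) (f i))"
    using Sum_any_Suc [OF fins(1) [of "\<lambda>i. (-1) ^ i * (x gchoose i)"]] by simp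
  also have "\<dots> - Sum_any (\<lambda>i. scale ((-1) ^ i * (x gchoose i)) (f (Suc i))) =
      Sum_any (\<lambda>i. scale ((-1) ^ i * (x gchoose i)) (f i - f (Suc i)))"
    by (simp add: Sum_any_diff [OF fins] scale_right_diff_distrib)
  finally show ?thesis .
qed

lemma res12_mult_z12:
  assumes "supported_in UNIV (cone T) F" "finite T"
  shows "res12 n m k (mult_z12 F) = res12 (n + 1) m k F"
proof -
  let ?f = "\<lambda>i::nat. F (- 1 - (m + of_int (n + 1) - of_nat i)) 0 (- 1 - (k + of_nat i)) 0"
  have eq: "mult_z12 F (- 1 - (m + of_int n - of_nat i)) 0 (- 1 - (k + of_nat i)) 0 =
      ?f i - ?f (Suc i)" for i
    by (simp add: mult_z12_def algebra_simps)
  have "Sum_any (\<lambda>i. scale ((-1) ^ i * ((of_int n + 1) gchoose i)) (?f i)) =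
      Sum_any (\<lambda>i. scale ((-1) ^ i * (of_int n gchoose i)) (?f i - ?f (Suc i)))"
    by (rule alternating_sum_Pascal [OF finite_res12 [OF assms]])
  then show ?thesis by (simp only: res12_def eq of_int_add of_int_1)
qed

lemma res21_mult_z12:
  assumes "supported_in (cone S) UNIV F" "finite S"
  shows "res21 n m k (mult_z12 F) = res21 (n + 1) m k F"
proof -
  let ?f = "\<lambda>i::nat. F (- 1 - (m + of_nat i)) 0 (- 1 - (k + of_int (n + 1) - of_nat i)) 0"
  let ?c = "(- 1) powi n :: complex"
  note fin = finite_res21 [OF assms]
  have fin1: "finite {i. ?f i \<noteq> 0}" by (rule fin)
  then have "finite {i. ?f (Suc i) \<noteq> 0}" by (rule finite_support_Suc)
  with fin1 have "finite ({i. ?f i \<noteq> 0} \<union> {i. ?f (Suc i) \<noteq> 0})" by blast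
  then have fin': "finite {i. ?f i - ?f (Suc i) \<noteq> 0}" by (rule rev_finite_subset) auto
  have eq: "mult_z12 F (- 1 - (m + of_nat i)) 0 (- 1 - (k + of_int n - of_nat i)) 0 =
      - (?f i - ?f (Suc i))" for i
    by (simp add: mult_z12_def algebra_simps)
  have "res21 n m k (mult_z12 F) =
      Sum_any (\<lambda>i. scale (- ?c) (scale ((-1) ^ i * (of_int n gchoose i)) (?f i - ?f (Suc i))))"
    unfolding res21_def minus_one_powi_add eq
    by (simp only: scale_minus_left scale_minus_right scale_scale mult.assoc mult_minus_left)
  also have "\<dots> = scale (- ?c) (Sum_any (\<lambda>i. scale ((-1) ^ i * (of_int n gchoose i)) (?f i - ?f (Suc i))))"
    by (rule Sum_any_hom [symmetric, OF finite_scale_support [OF fin']])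
      (simp_all only: scale_zero_right scale_right_distrib)
  also have "\<dots> = scale (- ?c) (Sum_any (\<lambda>i. scale ((-1) ^ i * (of_int (n + 1) gchoose i)) (?f i)))"
    using alternating_sum_Pascal [OF fin1, of "of_int n"] by (simp only: of_int_add of_int_1)
  also have "\<dots> = Sum_any (\<lambda>i. scale (- ?c) (scale ((-1) ^ i * (of_int (n + 1) gchoose i)) (?f i)))"
    by (rule Sum_any_hom [OF finite_scale_support [OF fin]])
      (simp_all only: scale_zero_right scale_right_distrib)
  also have "\<dots> = res21 (n + 1) m k F"
    unfolding res21_def minus_one_powi_add by (simp add: power_int_add mult.assoc)
  finally show ?thesis .
qed

lemma res12_mult_z12_funpow:
  assumes "supported_in UNIV (cone T) F" "finite T"
  shows "res12 (n - int N) m k ((mult_z12 ^^ N) F) = res12 n m k F"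
proof (induction N)
  case (Suc N)
  have "supported_in UNIV (cone T) ((mult_z12 ^^ N) F)"
    using assms(1) by (rule supported_in_mult_z12_funpow) (auto intro: cone_Suc)
  from res12_mult_z12 [OF this assms(2), of "n - int (Suc N)" m k] Suc show ?case
    by (simp add: algebra_simps)
qed simp

lemma res21_mult_z12_funpow:
  assumes "supported_in (cone S) UNIV F" "finite S"
  shows "res21 (n - int N) m k ((mult_z12 ^^ N) F) = res21 n m k F"
proof (induction N)
  case (Suc N)
  have "supported_in (cone S) UNIV ((mult_z12 ^^ N) F)"
    using assms(1) by (rule supported_in_mult_z12_funpow) (auto intro: cone_Suc)
  from res21_mult_z12 [OF this assms(2), of "n - int (Suc N)" m k] Suc show ?case
    by (simp add: algebra_simps)
qed simp

text \<open>
  For \<open>n \<ge> 0\<close> the power of \<open>z12\<close> is a polynomial, and the two expansions list its terms in opposite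
  orders.
\<close>
lemma res12_eq_res21:
  assumes "n \<ge> 0"
  shows "res12 n m k F = res21 n m k F"
proof -
  obtain p where n: "n = int p" using assms nonneg_int_cases by blast
  let ?f = "\<lambda>i. scale ((-1) ^ i * of_nat (p choose i))
     (F (- 1 - (m + of_nat p - of_nat i)) 0 (- 1 - (k + of_nat i)) 0)"
  let ?g = "\<lambda>i. scale ((-1) ^ (p + i) * of_nat (p choose i))
     (F (- 1 - (m + of_nat i)) 0 (- 1 - (k + of_nat p - of_nat i)) 0)"
  have "res12 n m k F = Sum_any ?f"
    by (simp add: res12_def n binomial_gbinomial)
  also have "\<dots> = (\<Sum>i\<le>p. ?f i)"
    by (rule Sum_any.expand_superset) (auto simp: not_less [symmetric] intro: ccontr)
  also have "\<dots> = (\<Sum>i\<le>p. ?f (p - i))"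
    using sum.nat_diff_reindex [of ?f "Suc p"] by (simp add: lessThan_Suc_atMost)
  also have "\<dots> = (\<Sum>i\<le>p. ?g i)"
  proof (rule sum.cong [OF refl])
    fix i assume "i \<in> {..p}"
    then obtain j where p: "p = i + j" using le_Suc_ex by auto
    show "?f (p - i) = ?g i"
      using binomial_symmetric [of i p] by (simp add: p power_add)
  qed
  also have "\<dots> = Sum_any ?g"
    by (rule Sum_any.expand_superset [symmetric]) (auto simp: not_less [symmetric] intro: ccontr)
  also have "\<dots> = res21 n m k F"
    unfolding res21_def n minus_one_powi_add by (simp add: binomial_gbinomial power_add)
  finally show ?thesis .
qed

text \<open>
  The difference of the two expansions of $z_{12}^{-1-J}$ is
  $\sum_{p\in\mathbb Z}\binom pJ z_1^{-p-1}z_2^{p-J}$, a derivative of the formal delta function. Its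
  terms with \<open>p \<ge> J\<close> make up the first expansion, those with \<open>p < 0\<close> the negative of the second one,
  and the coefficients in between vanish. Here \<open>p\<close> is \<open>\<gamma> + m\<close>, which has to be an integer: the two
  expansions only see exponents of \<open>z1\<close> in \<open>-m + \<int>\<close>.
\<close>
lemma res12_diff_res21:
  assumes supp: "cone_supported F"
    and int: "\<And>\<gamma>1 \<gamma>2. F \<gamma>1 0 \<gamma>2 0 \<noteq> 0 \<Longrightarrow> \<gamma>1 + m \<in> \<int>"
  shows "res12 (- 1 - int J) m k F - res21 (- 1 - int J) m k F =
    Sum_any (\<lambda>\<gamma>. scale ((\<gamma> + m) gchoose J) (F \<gamma> 0 (of_nat J - 1 - m - k - \<gamma>) 0))"
proof -
  let ?f = "\<lambda>\<gamma>. scale ((\<gamma> + m) gchoose J) (F \<gamma> 0 (of_nat J - 1 - m - k - \<gamma>) 0)"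
  \<comment> \<open>the exponents of \<open>z1\<close> that occur in the first and in the second residue\<close>
  define h1 h2 :: "nat \<Rightarrow> complex"
    where "h1 = (\<lambda>i. of_nat (J + i) - m)" and "h2 = (\<lambda>i. - of_nat (Suc i) - m)"
  have "Sum_any ?f = Sum_any (\<lambda>i. ?f (h1 i)) + Sum_any (\<lambda>i. ?f (h2 i))"
  proof (rule Sum_any_split)
    show "inj h1" "inj h2" by (auto simp: inj_on_def h1_def h2_def)
    have "h1 i \<noteq> h2 j" for i j
    proof
      assume "h1 i = h2 j"
      then have "of_nat (J + i + Suc j) = (0 :: complex)"
        unfolding h1_def h2_def by (simp add: algebra_simps)
      then show False by (simp only: of_nat_eq_0_iff)
    qed
    then show "range h1 \<inter> range h2 = {}" by blast
    show "finite {\<gamma>. ?f \<gamma> \<noteq> 0}"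
      by (rule finite_subset [OF _ cone_supported_finite [OF supp]]) auto
    show "{\<gamma>. ?f \<gamma> \<noteq> 0} \<subseteq> range h1 \<union> range h2"
    proof
      fix \<gamma> assume "\<gamma> \<in> {\<gamma>. ?f \<gamma> \<noteq> 0}"
      then have nz: "(\<gamma> + m) gchoose J \<noteq> 0" and "F \<gamma> 0 (of_nat J - 1 - m - k - \<gamma>) 0 \<noteq> 0"
        by auto
      with int obtain p where p: "\<gamma> + m = of_int p" unfolding Ints_def by blast
      then have \<gamma>: "\<gamma> = of_int p - m" by (simp add: eq_diff_eq)
      have "p < 0 \<or> p \<ge> int J"
      proof (rule ccontr)
        assume "\<not> (p < 0 \<or> p \<ge> int J)"
        then obtain q where "p = int q" "q < J" by (cases p) auto
        with nz p show False by (simp add: binomial_gbinomial [symmetric])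
      qed
      then show "\<gamma> \<in> range h1 \<union> range h2"
      proof
        assume "p < 0"
        then obtain q where "p = - int (Suc q)" by (cases p) auto
        then have "\<gamma> = h2 q" by (simp add: \<gamma> h2_def)
        then show ?thesis by blast
      next
        assume "p \<ge> int J"
        then obtain q where "p = int (J + q)" by (metis zle_iff_zadd of_nat_add)
        then have "\<gamma> = h1 q" by (simp add: \<gamma> h1_def)
        then show ?thesis by blast
      qed
    qed
  qed
  also have "Sum_any (\<lambda>i. ?f (h1 i)) = res12 (- 1 - int J) m k F"
  proof -
    have c: "(h1 i + m) gchoose J = (- 1) ^ i * (of_int (- 1 - int J) gchoose i)" for i
      by (simp add: h1_def gbinomial_neg_Suc binomial_gbinomial)
    have e1: "h1 i = - 1 - (m + of_int (- 1 - int J) - of_nat i)"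
      and e2: "of_nat J - 1 - m - k - h1 i = - 1 - (k + of_nat i)" for i
      by (simp_all add: h1_def algebra_simps)
    show ?thesis unfolding res12_def c e2 by (simp only: e1)
  qed
  also have "Sum_any (\<lambda>i. ?f (h2 i)) = - res21 (- 1 - int J) m k F"
  proof -
    have c: "(h2 i + m) gchoose J = - ((- 1) powi (- 1 - int J + int i) * (of_int (- 1 - int J) gchoose i))" for i
    proof -
      have "(h2 i + m) gchoose J = (- 1 - of_nat i) gchoose J" by (simp add: h2_def)
      also have "\<dots> = (- 1) ^ J * of_nat (J + i choose J)"
        using binomial_symmetric [of i "J + i"] by (simp add: gbinomial_neg_Suc add.commute)
      also have "\<dots> = - ((- 1) powi (- 1 - int J + int i) * (of_int (- 1 - int J) gchoose i))"
        using minus_one_powi_neg_Suc [of J]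
        by (simp add: gbinomial_neg_Suc minus_one_powi_add mult.assoc)
      finally show ?thesis .
    qed
    have e1: "h2 i = - 1 - (m + of_nat i)"
      and e2: "of_nat J - 1 - m - k - h2 i = - 1 - (k + of_int (- 1 - int J) - of_nat i)" for i
      by (simp_all add: h2_def algebra_simps)
    have "?f (h2 i) = - scale ((- 1) powi (- 1 - int J + int i) * (of_int (- 1 - int J) gchoose i))
       (F (- 1 - (m + of_nat i)) 0 (- 1 - (k + of_int (- 1 - int J) - of_nat i)) 0)" for i
      unfolding c e2 by (simp only: e1 scale_minus_left)
    then show ?thesis unfolding res21_def Sum_any.expand_set by (simp add: sum_negf)
  qed
  finally show ?thesis by simp
qed

end

section \<open>Falling factorials of an operator\<close>

locale linear_operator = complex_vector_space scale + Vector_Spaces.linear scale scale \<N>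
  for scale :: "complex \<Rightarrow> 'w::ab_group_add \<Rightarrow> 'w" and \<N>
begin

lemma falling_op_add:
  "falling_op scale m \<N> j (x + y) = falling_op scale m \<N> j x + falling_op scale m \<N> j y"
proof (induction j arbitrary: x y)
  case (Suc j)
  have "scale (m - of_nat j) (x + y) + \<N> (x + y) =
      (scale (m - of_nat j) x + \<N> x) + (scale (m - of_nat j) y + \<N> y)"
    by (simp add: add scale_right_distrib)
  then show ?case by (simp only: falling_op.simps Suc)
qed simp

lemma falling_op_scale:
  "falling_op scale m \<N> j (scale c x) = scale c (falling_op scale m \<N> j x)"
proof (induction j arbitrary: x)
  case (Suc j)
  have "scale (m - of_nat j) (scale c x) + \<N> (scale c x) =
      scale c (scale (m - of_nat j) x + \<N> x)"
    by (simp add: scale scale_right_distrib mult.commute)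
  then show ?case by (simp only: falling_op.simps Suc)
qed simp

lemma falling_op_commute: "falling_op scale m \<N> j (\<N> x) = \<N> (falling_op scale m \<N> j x)"
  by (induction j arbitrary: x) (simp_all add: falling_op_add falling_op_scale add scale)

text \<open>
  The definition applies the newest factor first. All factors are polynomials in \<open>\<N>\<close> and commute, so
  it can be applied last as well.
\<close>
lemma falling_op_Suc:
  "falling_op scale m \<N> (Suc j) x =
    scale (m - of_nat j) (falling_op scale m \<N> j x) + \<N> (falling_op scale m \<N> j x)"
  by (simp add: falling_op_add falling_op_scale falling_op_commute)

lemma linear_uminus: "linear_operator scale (\<lambda>x. - \<N> x)"
proof -
  have "Vector_Spaces.linear scale scale (\<lambda>x. - \<N> x)"
    unfolding module_hom_iff_linear [symmetric] module_hom_iff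
    by (simp add: add scale module_axioms)
  then show ?thesis
    by (simp add: linear_operator_def complex_vector_space_def vector_space_axioms)
qed

end

lemma binomial_sum_Suc:
  fixes f :: "nat \<Rightarrow> nat \<Rightarrow> 'a::ab_group_add" and scale :: "complex \<Rightarrow> 'a \<Rightarrow> 'a"
  assumes "complex_vector_space scale"
  shows "(\<Sum>j\<le>Suc J. scale (of_nat (Suc J choose j)) (f (Suc J - j) j)) =
    (\<Sum>j\<le>J. scale (of_nat (J choose j)) (f (Suc (J - j)) j + f (J - j) (Suc j)))"
proof -
  interpret complex_vector_space scale by fact
  have "(\<Sum>j\<le>Suc J. scale (of_nat (Suc J choose j)) (f (Suc J - j) j)) = f (Suc J) 0 +
     (\<Sum>j\<le>J. scale (of_nat (J choose j) + of_nat (J choose Suc j)) (f (J - j) (Suc j)))"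
    by (simp add: sum.atMost_Suc_shift del: sum.atMost_Suc)
  also have "\<dots> = (f (Suc J) 0 + (\<Sum>j\<le>J. scale (of_nat (J choose Suc j)) (f (J - j) (Suc j)))) +
     (\<Sum>j\<le>J. scale (of_nat (J choose j)) (f (J - j) (Suc j)))"
    by (simp add: scale_left_distrib sum.distrib add_ac)
  also have "f (Suc J) 0 + (\<Sum>j\<le>J. scale (of_nat (J choose Suc j)) (f (J - j) (Suc j))) =
      (\<Sum>j\<le>Suc J. scale (of_nat (J choose j)) (f (Suc J - j) j))"
    using sum.atMost_Suc_shift [of "\<lambda>j. scale (of_nat (J choose j)) (f (Suc J - j) j)" J]
    by (simp del: sum.atMost_Suc)
  also have "\<dots> = (\<Sum>j\<le>J. scale (of_nat (J choose j)) (f (Suc (J - j)) j))"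
    by (simp add: Suc_diff_le)
  finally show ?thesis by (simp add: scale_right_distrib sum.distrib)
qed

context linear_operator
begin

text \<open>
  The Vandermonde identity for the commuting operators $g-\mathcal N$ and $m+\mathcal N$, whose sum is
  the scalar \<open>g + m\<close>, multiplied by $J!$. In the induction step, splitting
  $\binom{J+1}{j}$ pairs the terms so that the two new factors $g-\mathcal N-(J-j)$ and $m+\mathcal N-j$
  add up to \<open>g + m - J\<close>, independently of \<open>j\<close>.
\<close>
lemma falling_op_Vandermonde:
  "(\<Sum>j\<le>J. scale (of_nat (J choose j))
      (falling_op scale g (\<lambda>x. - \<N> x) (J - j) (falling_op scale m \<N> j x))) =
    scale (\<Prod>i<J. g + m - of_nat i) x"
proof (induction J)
  case (Suc J)
  let ?M = "\<lambda>j. falling_op scale m \<N> j x" and ?G = "falling_op scale g (\<lambda>x. - \<N> x)"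
  interpret neg: linear_operator scale "\<lambda>x. - \<N> x" by (rule linear_uminus)
  have step: "?G (Suc (J - j)) (?M j) + ?G (J - j) (?M (Suc j)) =
      scale (g + m - of_nat J) (?G (J - j) (?M j))" if "j \<le> J" for j
  proof -
    have "?G (Suc (J - j)) (?M j) + ?G (J - j) (?M (Suc j)) = ?G (J - j)
      ((scale (g - of_nat (J - j)) (?M j) - \<N> (?M j)) + (scale (m - of_nat j) (?M j) + \<N> (?M j)))"
      unfolding falling_op_Suc neg.falling_op_add by simp
    also have "(scale (g - of_nat (J - j)) (?M j) - \<N> (?M j)) +
        (scale (m - of_nat j) (?M j) + \<N> (?M j)) = scale (g + m - of_nat J) (?M j)"
    proof -
      have "(scale (g - of_nat (J - j)) (?M j) - \<N> (?M j)) +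
          (scale (m - of_nat j) (?M j) + \<N> (?M j)) =
          scale (g - of_nat (J - j) + (m - of_nat j)) (?M j)"
        by (simp add: scale_left_distrib)
      also have "g - of_nat (J - j) + (m - of_nat j) = g + m - of_nat J"
        using that by (simp add: of_nat_diff)
      finally show ?thesis .
    qed
    finally show ?thesis by (simp only: neg.falling_op_scale)
  qed
  have "(\<Sum>j\<le>Suc J. scale (of_nat (Suc J choose j)) (?G (Suc J - j) (?M j))) =
     (\<Sum>j\<le>J. scale (of_nat (J choose j)) (?G (Suc (J - j)) (?M j) + ?G (J - j) (?M (Suc j))))"
    by (rule binomial_sum_Suc [OF complex_vector_space_axioms])
  also have "\<dots> = scale (g + m - of_nat J)
      (\<Sum>j\<le>J. scale (of_nat (J choose j)) (?G (J - j) (?M j)))"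
    unfolding scale_sum_right
    by (intro sum.cong refl) (simp add: step mult.commute del: falling_op.simps)
  also have "\<dots> = scale (\<Prod>i<Suc J. g + m - of_nat i) x"
    unfolding Suc.IH by (simp add: mult.commute)
  finally show ?case .
qed simp

lemma falling_op_closed:
  assumes add: "\<And>x y. x \<in> U \<Longrightarrow> y \<in> U \<Longrightarrow> x + y \<in> U" and scl: "\<And>c x. x \<in> U \<Longrightarrow> scale c x \<in> U"
    and inv: "\<And>x. x \<in> U \<Longrightarrow> \<N> x \<in> U" and x: "x \<in> U"
  shows "falling_op scale m \<N> j x \<in> U"
  by (induction j) (simp_all only: falling_op_Suc falling_op.simps(1) add scl inv x)

end

section \<open>The dependence of twisted fields on the logarithm\<close>

lemma exp_2pi_i_eq_1:
  assumes "exp (2 * pi * \<i> * w) = 1"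
  shows "w \<in> \<int>"
proof -
  let ?z = "2 * pi * \<i> * w"
  have "norm (exp ?z) = 1" using assms by simp
  then have re: "Im w = 0" by (simp add: norm_exp_eq_Re)
  have "Re (exp ?z) = 1" using assms by simp
  then have "cos (2 * pi * Re w) = 1" by (simp add: Re_exp re)
  then obtain n :: int where "2 * pi * Re w = n * 2 * pi" by (auto simp: cos_one_2pi_int)
  then have "w = of_int n" using re by (simp add: complex_eq_iff)
  then show ?thesis by simp
qed

context complex_vector_space
begin

text \<open>
  If \<open>e\<close> lists the coefficients of a polynomial $p(\zeta)$, then \<open>taylor_shift t e\<close> lists those of
  $p(\zeta+t)$.
\<close>
definition taylor_shift :: "complex \<Rightarrow> (nat \<Rightarrow> 'w) \<Rightarrow> nat \<Rightarrow> 'w" where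
  "taylor_shift t e l = Sum_any (\<lambda>k. scale (of_nat (k choose l) * t ^ (k - l)) (e k))"

lemma taylor_shift_eq_sum:
  assumes "\<And>k. k \<ge> l + K \<Longrightarrow> e k = 0"
  shows "taylor_shift t e l = (\<Sum>r<K. scale (of_nat (l + r choose l) * t ^ r) (e (l + r)))"
proof -
  let ?g = "\<lambda>k. scale (of_nat (k choose l) * t ^ (k - l)) (e k)"
  have "{k. ?g k \<noteq> 0} \<subseteq> {l..<l + K}"
  proof
    fix k assume "k \<in> {k. ?g k \<noteq> 0}"
    then have "k choose l \<noteq> 0" "e k \<noteq> 0" by auto
    with assms show "k \<in> {l..<l + K}" by (auto simp: not_less [symmetric])
  qed
  then have "taylor_shift t e l = sum ?g {l..<l + K}"
    unfolding taylor_shift_def by (intro Sum_any.expand_superset) simp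
  also have "\<dots> = (\<Sum>r<K. ?g (l + r))"
    by (rule sum.reindex_bij_witness [where i = "\<lambda>r. l + r" and j = "\<lambda>k. k - l"]) auto
  finally show ?thesis by simp
qed

lemma taylor_shift_diff:
  assumes "finite {k. d k \<noteq> 0}" "finite {k. e k \<noteq> 0}"
  shows "taylor_shift t (\<lambda>k. d k - e k) l = taylor_shift t d l - taylor_shift t e l"
  unfolding taylor_shift_def scale_right_diff_distrib
  by (intro Sum_any_diff finite_scale_support assms)

lemma finite_support_Max:
  fixes e :: "nat \<Rightarrow> 'w"
  assumes "finite {k. e k \<noteq> 0}" "e l \<noteq> 0"
  obtains L where "l \<le> L" "e L \<noteq> 0" "\<And>k. k > L \<Longrightarrow> e k = 0"
proof (rule that [of "Max {k. e k \<noteq> 0}"])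
  show "l \<le> Max {k. e k \<noteq> 0}" using assms by (intro Max_ge) auto
  show "e (Max {k. e k \<noteq> 0}) \<noteq> 0" using Max_in [OF assms(1)] assms(2) by auto
  show "e k = 0" if "k > Max {k. e k \<noteq> 0}" for k
    using Max_ge [OF assms(1), of k] that by (auto simp: not_le [symmetric])
qed

text \<open>
  A polynomial with $p(\zeta)=c\,p(\zeta+t)$ is zero unless \<open>c = 1\<close>, as a comparison of the leading
  coefficients shows.
\<close>
lemma quasi_periodic_polynomial_zero:
  assumes fin: "finite {k. e k \<noteq> 0}" and per: "\<And>l. e l = scale c (taylor_shift t e l)"
    and "c \<noteq> 1"
  shows "e l = 0"
proof (rule ccontr)
  assume "e l \<noteq> 0"
  then obtain L where L: "e L \<noteq> 0" "\<And>k. k > L \<Longrightarrow> e k = 0"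
    using finite_support_Max [OF fin] by metis
  have "taylor_shift t e L = (\<Sum>r<1. scale (of_nat (L + r choose L) * t ^ r) (e (L + r)))"
    by (rule taylor_shift_eq_sum) (use L in auto)
  with per [of L] have "scale 1 (e L) = scale c (e L)" by simp
  with L(1) \<open>c \<noteq> 1\<close> show False by (simp only: scale_right_imp_eq scale_cancel_right) simp
qed

text \<open>
  If $p(\zeta)=p(\zeta+t)$ has degree \<open>L > 0\<close>, then the coefficients at $\zeta^{L-1}$ differ by
  \<open>L t\<close> times the leading coefficient.
\<close>
lemma periodic_polynomial_constant:
  assumes fin: "finite {k. e k \<noteq> 0}" and per: "\<And>l. e l = taylor_shift t e l"
    and "t \<noteq> 0"
  shows "e (Suc l) = 0"
proof (rule ccontr)
  assume "e (Suc l) \<noteq> 0"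
  then obtain L where "Suc l \<le> L" and L: "e L \<noteq> 0" "\<And>k. k > L \<Longrightarrow> e k = 0"
    using finite_support_Max [OF fin] by metis
  then obtain p where p: "L = Suc p" using Suc_le_D by blast
  have "taylor_shift t e p = (\<Sum>r<2. scale (of_nat (p + r choose p) * t ^ r) (e (p + r)))"
    by (rule taylor_shift_eq_sum) (use L p in auto)
  then have "taylor_shift t e p = e p + scale (of_nat (Suc p) * t) (e L)"
    by (simp add: numeral_2_eq_2 p)
  with per [of p] have "scale (of_nat (Suc p) * t) (e L) = 0" by simp
  with L(1) \<open>t \<noteq> 0\<close> show False by (simp del: of_nat_Suc)
qed

lemma monodromy_eq_taylor_shift:
  "monodromy scale f \<gamma> l = scale (exp (2 * pi * \<i> * \<gamma>)) (taylor_shift (2 * pi * \<i>) (f \<gamma>) l)"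
  by (simp add: monodromy_def taylor_shift_def)

end

text \<open>
  A twisted module together with the decomposition $\varphi=\sigma e^{-2\pi i\mathcal N}$, reduced to
  what the logarithmic structure of the fields depends on: linearity, commutation and nilpotency.
\<close>
locale log_twisted_module = twisted_module scaleV vac prd scaleW \<phi> Y
  for scaleV :: "complex \<Rightarrow> 'v::ab_group_add \<Rightarrow> 'v"
    and vac :: 'v
    and prd :: "int \<Rightarrow> 'v \<Rightarrow> 'v \<Rightarrow> 'v"
    and scaleW :: "complex \<Rightarrow> 'w::ab_group_add \<Rightarrow> 'w"
    and \<phi> :: "'v \<Rightarrow> 'v"
    and Y :: "'v \<Rightarrow> 'w lfield" +
  fixes \<sigma> \<N> :: "'v \<Rightarrow> 'v"
  assumes \<sigma>_linear: "Vector_Spaces.linear scaleV scaleV \<sigma>"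
    and \<N>_linear: "Vector_Spaces.linear scaleV scaleV \<N>"
    and \<N>_nilpotent: "locally_nilpotent_op \<N>"
    and \<sigma>_\<N>: "\<sigma> (\<N> a) = \<N> (\<sigma> a)"
    and \<phi>_eq: "\<phi> a = \<sigma> (exp_op scaleV (- (2 * pi * \<i>)) \<N> a)"
begin

sublocale fields: complex_vector_space scaleW
  by unfold_locales

sublocale nil: linear_operator scaleV \<N>
  using \<N>_linear by (simp add: linear_operator_def complex_vector_space_def V.vector_space_axioms)

sublocale sem: Vector_Spaces.linear scaleV scaleV \<sigma>
  by (rule \<sigma>_linear)

lemma Y_add: "Y (x + y) v \<gamma> l = Y x v \<gamma> l + Y y v \<gamma> l"
  and Y_scale: "Y (scaleV c x) v \<gamma> l = scaleW c (Y x v \<gamma> l)"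
  and Y_zero: "Y 0 v \<gamma> l = 0"
  and Y_sum: "Y (sum f A) v \<gamma> l = (\<Sum>i\<in>A. Y (f i) v \<gamma> l)"
proof -
  interpret Vector_Spaces.linear scaleV scaleW "\<lambda>x. Y x v \<gamma> l" by (rule Y_linear)
  show "Y (x + y) v \<gamma> l = Y x v \<gamma> l + Y y v \<gamma> l" by (rule add)
  show "Y (scaleV c x) v \<gamma> l = scaleW c (Y x v \<gamma> l)" by (rule scale)
  show "Y 0 v \<gamma> l = 0" by (rule zero)
  show "Y (sum f A) v \<gamma> l = (\<Sum>i\<in>A. Y (f i) v \<gamma> l)" by (rule sum)
qed

lemma \<N>_funpow_zero: "(\<N> ^^ r) 0 = 0"
  by (induction r) (simp_all add: nil.zero)

lemma \<N>_funpow_eq_0: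
  assumes "(\<N> ^^ R) a = 0" "R \<le> r"
  shows "(\<N> ^^ r) a = 0"
proof -
  have "(\<N> ^^ r) a = (\<N> ^^ ((r - R) + R)) a" using assms(2) by simp
  also have "\<dots> = (\<N> ^^ (r - R)) ((\<N> ^^ R) a)" by (simp only: funpow_add comp_apply)
  finally show ?thesis by (simp add: assms(1) \<N>_funpow_zero)
qed

lemma eigenvector_\<N>: "\<sigma> a = scaleV c a \<Longrightarrow> \<sigma> (\<N> a) = scaleV c (\<N> a)"
  by (simp add: \<sigma>_\<N> nil.scale)

lemma eigenvector_\<N>_funpow: "\<sigma> a = scaleV c a \<Longrightarrow> \<sigma> ((\<N> ^^ r) a) = scaleV c ((\<N> ^^ r) a)"
  by (induction r) (simp_all add: eigenvector_\<N>)

text \<open>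
  Equivariance under $\varphi$, applied to an eigenvector of $\sigma$ and read off at one exponent
  $\gamma$: with $p_x(\zeta)$ the coefficient of $z^\gamma$ in \<open>Y(x,z)v\<close>, it says
  $p_{e^{-2\pi i\mathcal N}a}(\zeta)=e^{2\pi i(\gamma+m)}p_a(\zeta+2\pi i)$.
\<close>
lemma monodromy_on_eigenvector:
  assumes eig: "\<sigma> a = scaleV (exp (- (2 * pi * \<i> * m))) a" and R: "(\<N> ^^ R) a = 0"
  shows "(\<Sum>r<R. scaleW ((- (2 * pi * \<i>)) ^ r / fact r) (Y ((\<N> ^^ r) a) v \<gamma> l)) =
    scaleW (exp (2 * pi * \<i> * (\<gamma> + m))) (fields.taylor_shift (2 * pi * \<i>) (Y a v \<gamma>) l)"
proof -
  let ?t = "2 * pi * \<i>"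
  let ?S = "\<Sum>r<R. scaleW ((- ?t) ^ r / fact r) (Y ((\<N> ^^ r) a) v \<gamma> l)"
  have "exp_op scaleV (- ?t) \<N> a = (\<Sum>r<R. scaleV ((- ?t) ^ r / fact r) ((\<N> ^^ r) a))"
    unfolding exp_op_def
  proof (rule Sum_any.expand_superset)
    show "{r. scaleV ((- ?t) ^ r / fact r) ((\<N> ^^ r) a) \<noteq> 0} \<subseteq> {..<R}"
    proof
      fix r assume "r \<in> {r. scaleV ((- ?t) ^ r / fact r) ((\<N> ^^ r) a) \<noteq> 0}"
      then have "(\<N> ^^ r) a \<noteq> 0" by auto
      then have "\<not> R \<le> r" using \<N>_funpow_eq_0 [OF R] by blast
      then show "r \<in> {..<R}" by simp
    qed
  qed simp
  then have "\<phi> a = scaleV (exp (- (?t * m))) (\<Sum>r<R. scaleV ((- ?t) ^ r / fact r) ((\<N> ^^ r) a))"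
    by (simp add: \<phi>_eq sem.sum sem.scale eigenvector_\<N>_funpow [OF eig] V.scale_sum_right mult.commute)
  then have "Y (\<phi> a) v \<gamma> l = scaleW (exp (- (?t * m))) ?S"
    by (simp add: Y_scale Y_sum)
  moreover have "exp (?t * m) * exp (- (?t * m)) = 1" by (simp add: exp_minus)
  ultimately have "?S = scaleW (exp (?t * m)) (Y (\<phi> a) v \<gamma> l)" by simp
  moreover have "exp (?t * (\<gamma> + m)) = exp (?t * m) * exp (?t * \<gamma>)"
    by (simp only: mult_exp_exp distrib_left add.commute)
  ultimately show ?thesis
    by (simp only: Y_equivariant fields.monodromy_eq_taylor_shift W.scale_scale)
qed

text \<open>
  In closed form, $Y(a,z)=X(e^{-\zeta\mathcal N}a,z)$ with exponents in \<open>-m + \<int>\<close>. The proof is by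
  induction on the nilpotency order of \<open>\<N>\<close> at \<open>a\<close>. The claim for $\mathcal N^r a$ with \<open>r > 0\<close> turns
  the monodromy relation into one that involves only the coefficients \<open>y\<close> of \<open>Y(a,z)v\<close> and the
  expected coefficients \<open>u\<close>, namely $y(\zeta)-u(\zeta)+u(\zeta+2\pi i)=c\,y(\zeta+2\pi i)$ with
  $c=e^{2\pi i(\gamma+m)}$. If \<open>c = 1\<close>, then \<open>y - u\<close> is periodic, hence constant, and its constant term
  vanishes. Otherwise \<open>\<gamma>\<close> is not in \<open>-m + \<int>\<close>, so that \<open>u\<close> is constant by induction, and \<open>y\<close> is
  quasi-periodic with factor \<open>c \<noteq> 1\<close>, hence zero.
\<close>
lemma log_structure:
  assumes "\<sigma> a = scaleV (exp (- (2 * pi * \<i> * m))) a" "(\<N> ^^ R) a = 0"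
  shows "(\<forall>l. Y a v \<gamma> l = scaleW ((- 1) ^ l / fact l) (Y ((\<N> ^^ l) a) v \<gamma> 0)) \<and>
    (\<forall>l. Y a v \<gamma> l \<noteq> 0 \<longrightarrow> \<gamma> + m \<in> \<int>)"
  using assms
proof (induction R arbitrary: a)
  case 0
  then show ?case by (simp add: Y_zero \<N>_funpow_zero)
next
  case (Suc R)
  let ?t = "2 * pi * \<i>" and ?c = "exp (2 * pi * \<i> * (\<gamma> + m))"
  let ?y = "Y a v \<gamma>"
  define u where "u s = scaleW ((- 1) ^ s / fact s) (Y ((\<N> ^^ s) a) v \<gamma> 0)" for s
  have zero: "(\<N> ^^ r) a = 0" if "r \<ge> Suc R" for r
    using \<N>_funpow_eq_0 [OF Suc.prems(2) that] .
  have IH: "Y ((\<N> ^^ Suc r) a) v \<gamma> l =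
      scaleW ((- 1) ^ l / fact l) (Y ((\<N> ^^ (l + Suc r)) a) v \<gamma> 0)"
    and IH_int: "Y ((\<N> ^^ Suc r) a) v \<gamma> l \<noteq> 0 \<Longrightarrow> \<gamma> + m \<in> \<int>" for r l
  proof -
    have "(\<N> ^^ R) ((\<N> ^^ Suc r) a) = (\<N> ^^ (R + Suc r)) a"
      by (simp only: funpow_add comp_apply)
    also have "\<dots> = 0" by (rule zero) simp
    finally have "(\<N> ^^ R) ((\<N> ^^ Suc r) a) = 0" .
    note * = Suc.IH [OF eigenvector_\<N>_funpow [OF Suc.prems(1)] this]
    then show "Y ((\<N> ^^ Suc r) a) v \<gamma> l =
      scaleW ((- 1) ^ l / fact l) (Y ((\<N> ^^ (l + Suc r)) a) v \<gamma> 0)"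
      by (simp only: funpow_add comp_apply)
    show "Y ((\<N> ^^ Suc r) a) v \<gamma> l \<noteq> 0 \<Longrightarrow> \<gamma> + m \<in> \<int>" using * by blast
  qed
  have u_zero: "u k = 0" if "k \<ge> Suc R" for k
    using zero [OF that] by (simp add: u_def Y_zero)
  have fin_u: "finite {k. u k \<noteq> 0}"
    by (rule finite_subset [of _ "{..R}"]) (use u_zero in \<open>auto simp: not_less_eq_eq [symmetric]\<close>)
  have fin_y: "finite {k. ?y k \<noteq> 0}"
    by (rule fields.LFie_finite_log_degree [OF Y_field])
  \<comment> \<open>the terms of $e^{-2\pi i\mathcal N}$ with \<open>r > 0\<close> are Taylor coefficients of \<open>u\<close> shifted by $2\pi i$\<close>
  have coeff: "scaleW ((- ?t) ^ Suc r / fact (Suc r)) (Y ((\<N> ^^ Suc r) a) v \<gamma> l) =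
      scaleW (of_nat (l + Suc r choose l) * ?t ^ Suc r) (u (l + Suc r))" for r l
  proof -
    have "(- ?t) ^ Suc r / fact (Suc r) * ((- 1) ^ l / fact l) =
        of_nat (l + Suc r choose l) * ?t ^ Suc r * ((- 1) ^ (l + Suc r) / fact (l + Suc r))"
    proof -
      have "of_nat (l + Suc r choose l) = (fact (l + Suc r) / (fact l * fact (Suc r)) :: complex)"
        by (subst binomial_fact) auto
      moreover have "(- ?t) ^ Suc r = (- 1) ^ Suc r * ?t ^ Suc r"
        by (rule power_minus)
      ultimately show ?thesis
        by (simp only: power_add) (simp add: field_simps del: fact_Suc power_Suc)
    qed
    then show ?thesis unfolding IH u_def by (simp only: W.scale_scale)
  qed
  have main: "?y l - u l + fields.taylor_shift ?t u l =
      scaleW ?c (fields.taylor_shift ?t ?y l)" for l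
  proof -
    have "fields.taylor_shift ?t u l =
        (\<Sum>r<Suc R. scaleW (of_nat (l + r choose l) * ?t ^ r) (u (l + r)))"
      by (rule fields.taylor_shift_eq_sum) (simp add: u_zero)
    also have "\<dots> = u l + (\<Sum>r<R. scaleW (of_nat (l + Suc r choose l) * ?t ^ Suc r) (u (l + Suc r)))"
      by (subst sum.lessThan_Suc_shift) simp
    also have "\<dots> = u l + (\<Sum>r<R. scaleW ((- ?t) ^ Suc r / fact (Suc r)) (Y ((\<N> ^^ Suc r) a) v \<gamma> l))"
      by (simp only: coeff)
    finally have "?y l - u l + fields.taylor_shift ?t u l =
        (\<Sum>r<Suc R. scaleW ((- ?t) ^ r / fact r) (Y ((\<N> ^^ r) a) v \<gamma> l))"
      by (subst sum.lessThan_Suc_shift) simp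
    then show ?thesis using monodromy_on_eigenvector [OF Suc.prems] by simp
  qed
  show ?case
  proof (cases "?c = 1")
    case True
    then have int: "\<gamma> + m \<in> \<int>" by (rule exp_2pi_i_eq_1)
    define e where "e k = ?y k - u k" for k
    have fin_e: "finite {k. e k \<noteq> 0}"
      by (rule finite_subset [OF _ finite_UnI [OF fin_y fin_u]]) (auto simp: e_def)
    have "e l = fields.taylor_shift ?t e l" for l
      using main [of l] unfolding e_def fields.taylor_shift_diff [OF fin_y fin_u] True
      by (simp add: algebra_simps)
    then have "e (Suc l) = 0" for l
      by (rule fields.periodic_polynomial_constant [OF fin_e]) simp
    moreover have "e 0 = 0" by (simp add: e_def u_def)
    ultimately have "e l = 0" for l by (cases l) auto
    then have "?y l = u l" for l unfolding e_def by simp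
    with int show ?thesis by (simp add: u_def)
  next
    case False
    have "\<gamma> + m \<notin> \<int>"
    proof
      assume "\<gamma> + m \<in> \<int>"
      then obtain p where "\<gamma> + m = of_int p" unfolding Ints_def by blast
      with False show False using cis_multiple_2pi [of "of_int p"] by (simp add: cis_conv_exp mult_ac)
    qed
    then have Nz: "Y ((\<N> ^^ Suc r) a) v \<gamma> l = 0" for r l using IH_int by blast
    then have uz: "u (Suc k) = 0" for k by (simp add: u_def del: funpow.simps)
    have "fields.taylor_shift ?t u l =
        (\<Sum>r<1. scaleW (of_nat (l + r choose l) * ?t ^ r) (u (l + r)))" for l
      by (rule fields.taylor_shift_eq_sum) (use uz in \<open>auto dest!: Suc_le_D\<close>)
    then have "fields.taylor_shift ?t u l = u l" for l by simp
    with main have "?y l = scaleW ?c (fields.taylor_shift ?t ?y l)" for l by simp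
    then have yz: "?y l = 0" for l
      using False by (rule fields.quasi_periodic_polynomial_zero [OF fin_y])
    have "Y ((\<N> ^^ l) a) v \<gamma> 0 = 0" for l
      using yz Nz by (cases l) auto
    with yz show ?thesis by simp
  qed
qed

text \<open>
  The structure of the fields in differential form, $\partial_\zeta Y(a,z)=-Y(\mathcal N a,z)$.
\<close>
lemma log_derivative:
  assumes "\<sigma> a = scaleV (exp (- (2 * pi * \<i> * m))) a"
  shows "scaleW (of_nat (Suc l)) (Y a v \<gamma> (Suc l)) = - Y (\<N> a) v \<gamma> l"
proof -
  obtain R where "(\<N> ^^ R) a = 0" using \<N>_nilpotent unfolding locally_nilpotent_op_def by blast
  then have R: "(\<N> ^^ R) a = 0" "(\<N> ^^ R) (\<N> a) = 0"
    by (simp_all add: nil.zero flip: funpow_swap1)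
  have "Y a v \<gamma> (Suc l) = scaleW ((- 1) ^ Suc l / fact (Suc l)) (Y ((\<N> ^^ Suc l) a) v \<gamma> 0)"
    using log_structure [OF assms R(1)] by blast
  moreover have "Y (\<N> a) v \<gamma> l = scaleW ((- 1) ^ l / fact l) (Y ((\<N> ^^ l) (\<N> a)) v \<gamma> 0)"
    using log_structure [OF eigenvector_\<N> [OF assms] R(2)] by blast
  moreover have "(\<N> ^^ Suc l) a = (\<N> ^^ l) (\<N> a)" by (simp add: funpow_swap1)
  moreover have "of_nat (Suc l) * ((- 1) ^ Suc l / fact (Suc l)) = - ((- 1) ^ l / fact l :: complex)"
    by (simp add: field_simps del: of_nat_Suc)
  ultimately show ?thesis by (simp only: W.scale_scale W.scale_minus_left)
qed

lemma support_coset: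
  assumes "\<sigma> a = scaleV (exp (- (2 * pi * \<i> * m))) a" "Y a v \<gamma> l \<noteq> 0"
  shows "\<gamma> + m \<in> \<int>"
  using log_structure [OF assms(1)] assms(2) \<N>_nilpotent unfolding locally_nilpotent_op_def by blast

section \<open>Products of local twisted fields\<close>

text \<open>
  The series $F_x=z_{12}^M Y(x,z_1)Y(b,z_2)v$, as a function of \<open>x\<close>. It is linear in \<open>x\<close>, which allows
  operators on \<open>V\<close> to be moved in and out of its coefficients.
\<close>
definition local_series :: "nat \<Rightarrow> 'v \<Rightarrow> 'w \<Rightarrow> 'v \<Rightarrow> 'w series2" where
  "local_series M b v x = (mult_z12 ^^ M) (prod12 (Y x) (Y b) v)"

lemma local_series_add: "local_series M b v (x + y) \<gamma>1 l1 \<gamma>2 l2 =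
    local_series M b v x \<gamma>1 l1 \<gamma>2 l2 + local_series M b v y \<gamma>1 l1 \<gamma>2 l2"
  by (simp add: local_series_def prod12_def Y_add mult_z12_funpow_add)

lemma local_series_scale: "local_series M b v (scaleV c x) \<gamma>1 l1 \<gamma>2 l2 =
    scaleW c (local_series M b v x \<gamma>1 l1 \<gamma>2 l2)"
  unfolding local_series_def
  by (rule mult_z12_funpow_pointwise [of "\<lambda>w. w" "scaleW c"])
    (simp_all add: W.scale_right_diff_distrib prod12_def Y_scale)

lemma local_series_sum: "local_series M b v (sum f A) \<gamma>1 l1 \<gamma>2 l2 =
    (\<Sum>j\<in>A. local_series M b v (f j) \<gamma>1 l1 \<gamma>2 l2)"
proof -
  have "local_series M b v 0 \<gamma>1 l1 \<gamma>2 l2 = 0"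
    using local_series_scale [of M b v 0 0] by simp
  then show ?thesis
    by (induction A rule: infinite_finite_induct) (simp_all add: local_series_add)
qed

lemma local_series_log:
  assumes "\<sigma> x = scaleV (exp (- (2 * pi * \<i> * m))) x"
  shows "scaleW (of_nat (Suc l1)) (local_series M b v x \<gamma>1 (Suc l1) \<gamma>2 l2) =
    - local_series M b v (\<N> x) \<gamma>1 l1 \<gamma>2 l2"
  unfolding local_series_def
  by (rule mult_z12_funpow_pointwise)
    (simp_all only: W.scale_right_diff_distrib minus_diff_minus prod12_def log_derivative [OF assms])

text \<open>
  Since $\partial_{\zeta_1}$ acts on $F_x$ as $-\mathcal N$ acts on \<open>x\<close>, the operator $D_{z_1}$ takes
  the coefficient of $z_1^g$ to the one of $z_1^{g-1}$ and multiplies it by $g-\mathcal N$. The factors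
  met on the way from the exponent \<open>\<gamma>1 + J\<close> down to \<open>\<gamma>1\<close> form a falling factorial.
\<close>
lemma D_z1_funpow_local_series:
  assumes "\<sigma> x = scaleV (exp (- (2 * pi * \<i> * m))) x"
  shows "(D_z1 scaleW ^^ J) (local_series M b v x) \<gamma>1 l1 \<gamma>2 l2 =
    local_series M b v (falling_op scaleV (\<gamma>1 + of_nat J) (\<lambda>x. - \<N> x) J x) (\<gamma>1 + of_nat J) l1 \<gamma>2 l2"
proof (induction J arbitrary: \<gamma>1 l1)
  case (Suc J)
  interpret neg: linear_operator scaleV "\<lambda>x. - \<N> x" by (rule nil.linear_uminus)
  let ?U = "{x. \<sigma> x = scaleV (exp (- (2 * pi * \<i> * m))) x}"
  let ?g = "\<gamma>1 + of_nat (Suc J)"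
  let ?x = "falling_op scaleV ?g (\<lambda>x. - \<N> x) J x"
  have "?x \<in> ?U"
    by (rule neg.falling_op_closed)
      (simp_all add: assms sem.add sem.scale sem.neg eigenvector_\<N> V.scale_right_distrib mult.commute)
  then have log: "scaleW (of_nat (Suc l1)) (local_series M b v ?x ?g (Suc l1) \<gamma>2 l2) =
      - local_series M b v (\<N> ?x) ?g l1 \<gamma>2 l2"
    by (intro local_series_log [where m = m]) blast
  have g: "\<gamma>1 + 1 + of_nat J = ?g" by simp
  have "(D_z1 scaleW ^^ Suc J) (local_series M b v x) \<gamma>1 l1 \<gamma>2 l2 =
      scaleW (\<gamma>1 + 1) (local_series M b v ?x ?g l1 \<gamma>2 l2) +
      scaleW (of_nat (Suc l1)) (local_series M b v ?x ?g (Suc l1) \<gamma>2 l2)"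
    unfolding funpow.simps comp_apply D_z1_def Suc.IH g by simp
  also have "\<dots> = local_series M b v (scaleV (\<gamma>1 + 1) ?x + scaleV (- 1) (\<N> ?x)) ?g l1 \<gamma>2 l2"
    unfolding log local_series_add local_series_scale by simp
  also have "scaleV (\<gamma>1 + 1) ?x + scaleV (- 1) (\<N> ?x) = falling_op scaleV ?g (\<lambda>x. - \<N> x) (Suc J) x"
    unfolding neg.falling_op_Suc by simp
  finally show ?case .
qed simp

lemma local_series_coset:
  assumes "\<sigma> x = scaleV (exp (- (2 * pi * \<i> * m))) x" "local_series M b v x \<gamma>1 l1 \<gamma>2 l2 \<noteq> 0"
  shows "\<gamma>1 + m \<in> \<int>"
proof -
  have "supported_in {\<gamma>. \<gamma> + m \<in> \<int>} UNIV (prod12 (Y x) (Y b) v)"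
    using support_coset [OF assms(1)] by (simp add: supported_in_def prod12_def) 
  then have "supported_in {\<gamma>. \<gamma> + m \<in> \<int>} UNIV (local_series M b v x)"
    unfolding local_series_def
  proof (rule supported_in_mult_z12_funpow)
    fix \<gamma> assume "\<gamma> - 1 \<in> {\<gamma>. \<gamma> + m \<in> \<int>}"
    then have "\<gamma> - 1 + m \<in> \<int>" by blast
    then have "\<gamma> - 1 + m + 1 \<in> \<int>" by (rule Ints_add) (rule Ints_1)
    then show "\<gamma> \<in> {\<gamma>. \<gamma> + m \<in> \<int>}" by (simp add: add_ac)
  qed simp
  with assms(2) show ?thesis unfolding supported_in_def by blast
qed

lemma mode_eq: "mode scaleW Y \<N> m a v = Y a v (- 1 - m) 0"
  by (simp add: mode_def Res_z_def mult_z_pow_def X_field_def)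

text \<open>
  A mode of a product is a coefficient of $D_{z_1}^{(p)}F_x$ on the diagonal. The sum is over the
  exponent \<open>g\<close> of \<open>z1\<close> before differentiation, so that sums for different \<open>p\<close> can be added termwise.
\<close>
lemma mode_product:
  fixes q :: complex and v :: 'w
  assumes x: "\<sigma> x = scaleV (exp (- (2 * pi * \<i> * m))) x" and loc: "local_with M (Y x) (Y b)"
    and p: "n = int M - 1 - int p"
  defines "h \<equiv> \<lambda>g. local_series M b v (falling_op scaleV g (\<lambda>x. - \<N> x) p x) g 0 (of_nat p - 1 - q - g) 0"
  shows "mode scaleW Y \<N> q (prd n x b) v = scaleW (1 / fact p) (Sum_any h)"
    and "finite {g. h g \<noteq> 0}"
proof -
  let ?D = "(D_z1 scaleW ^^ p) (local_series M b v x)"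
  have supp: "cone_supported (local_series M b v x)"
    unfolding local_series_def
    by (rule fields.local_product_cone_supported [OF Y_field Y_field loc])
  have D: "?D \<gamma> 0 (- 1 - q - \<gamma>) 0 = h (\<gamma> + of_nat p)" for \<gamma>
    unfolding D_z1_funpow_local_series [OF x] h_def by (simp add: algebra_simps)
  have bij: "bij (\<lambda>\<gamma>::complex. \<gamma> + of_nat p)"
    by (rule o_bij [of "\<lambda>g. g - of_nat p"]) auto
  have "finite {\<gamma>. ?D \<gamma> 0 (- 1 - q - \<gamma>) 0 \<noteq> 0}"
    by (rule finite_subset [OF _
          cone_supported_finite [OF fields.cone_supported_D_z1_funpow [OF supp], of p "- 1 - q"]]) blast
  then have "finite {\<gamma>. h (\<gamma> + of_nat p) \<noteq> 0}" unfolding D .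
  then have "finite ((\<lambda>\<gamma>. \<gamma> + of_nat p) ` {\<gamma>. h (\<gamma> + of_nat p) \<noteq> 0})" by simp
  then show "finite {g. h g \<noteq> 0}"
    by (rule rev_finite_subset) (auto simp: image_iff intro!: exI [of _ "_ - of_nat p"])
  have nat: "nat (int M - 1 - n) = p" "n \<le> int M - 1" using p by simp_all
  have "mode scaleW Y \<N> q (prd n x b) v = field_prd_with scaleW M n (Y x) (Y b) v (- 1 - q) 0"
    by (simp add: mode_eq Y_prd fields.field_prd_eq_with [OF Y_field Y_field loc])
  also have "\<dots> = scaleW (1 / fact p) (diag ?D (- 1 - q) 0)"
    using supp nat by (simp add: fields.field_prd_with_eq local_series_def)
  also have "diag ?D (- 1 - q) 0 = Sum_any (\<lambda>\<gamma>. h (\<gamma> + of_nat p))"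
    by (simp add: diag_def D)
  also have "\<dots> = Sum_any h" by (rule Sum_any_reindex_bij [OF bij])
  finally show "mode scaleW Y \<N> q (prd n x b) v = scaleW (1 / fact p) (Sum_any h)" .
qed

lemma mode_product_eq_0:
  assumes loc: "local_with M (Y x) (Y b)" and "n \<ge> int M"
  shows "mode scaleW Y \<N> q (prd n x b) v = 0"
  using assms(2)
  by (simp add: mode_eq Y_prd fields.field_prd_eq_with [OF Y_field Y_field loc] field_prd_with_def)

text \<open>
  The eigenvectors of $\sigma$ for which one exponent \<open>M\<close> serves the whole \<open>\<N>\<close>-orbit. They form a subspace stable under
  \<open>\<N>\<close>, hence under the operators $\binom{m+\mathcal N}{j}$, so that all products on the right of the
  Borcherds identity can be computed with the same \<open>M\<close>.
\<close>
definition jointly_local :: "nat \<Rightarrow> 'v \<Rightarrow> complex \<Rightarrow> 'v set" where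
  "jointly_local M b m = {x. \<sigma> x = scaleV (exp (- (2 * pi * \<i> * m))) x \<and>
     (\<forall>r. local_with M (Y ((\<N> ^^ r) x)) (Y b))}"

lemma \<N>_funpow_linear:
  "(\<N> ^^ r) (x + y) = (\<N> ^^ r) x + (\<N> ^^ r) y" "(\<N> ^^ r) (scaleV c x) = scaleV c ((\<N> ^^ r) x)"
  by (induction r) (simp_all add: nil.add nil.scale)

lemma prod21_add: "prod21 (Y (x + y)) (Y b) v =
    (\<lambda>\<gamma>1 l1 \<gamma>2 l2. prod21 (Y x) (Y b) v \<gamma>1 l1 \<gamma>2 l2 + prod21 (Y y) (Y b) v \<gamma>1 l1 \<gamma>2 l2)"
  and prod21_scale: "prod21 (Y (scaleV c x)) (Y b) v =
    (\<lambda>\<gamma>1 l1 \<gamma>2 l2. scaleW c (prod21 (Y x) (Y b) v \<gamma>1 l1 \<gamma>2 l2))"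
proof -
  have "Y b (u + w) \<gamma> l = Y b u \<gamma> l + Y b w \<gamma> l" 
    "Y b (scaleW c u) \<gamma> l = scaleW c (Y b u \<gamma> l)" for u w \<gamma> l
    using fields.LFie_linear [OF Y_field, of b \<gamma> l]
    unfolding module_hom_iff_linear [symmetric] module_hom_iff by blast+
  then show "prod21 (Y (x + y)) (Y b) v =
    (\<lambda>\<gamma>1 l1 \<gamma>2 l2. prod21 (Y x) (Y b) v \<gamma>1 l1 \<gamma>2 l2 + prod21 (Y y) (Y b) v \<gamma>1 l1 \<gamma>2 l2)"
  "prod21 (Y (scaleV c x)) (Y b) v =
    (\<lambda>\<gamma>1 l1 \<gamma>2 l2. scaleW c (prod21 (Y x) (Y b) v \<gamma>1 l1 \<gamma>2 l2))"
    by (simp_all add: prod21_def Y_add Y_scale)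
qed

lemma local_with_add:
  assumes "local_with M (Y x) (Y b)" "local_with M (Y y) (Y b)"
  shows "local_with M (Y (x + y)) (Y b)"
  unfolding local_with_def
proof (intro allI ext)
  fix v \<gamma>1 l1 \<gamma>2 l2
  show "(mult_z12 ^^ M) (prod12 (Y (x + y)) (Y b) v) \<gamma>1 l1 \<gamma>2 l2 =
      (mult_z12 ^^ M) (prod21 (Y (x + y)) (Y b) v) \<gamma>1 l1 \<gamma>2 l2"
    using assms local_series_add [of M b v x y]
    by (simp add: local_with_def local_series_def prod21_add mult_z12_funpow_add)
qed

lemma local_with_scale:
  assumes "local_with M (Y x) (Y b)"
  shows "local_with M (Y (scaleV c x)) (Y b)"
  unfolding local_with_def
proof (intro allI ext)
  fix v \<gamma>1 l1 \<gamma>2 l2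
  have "(mult_z12 ^^ M) (prod21 (Y (scaleV c x)) (Y b) v) \<gamma>1 l1 \<gamma>2 l2 =
      scaleW c ((mult_z12 ^^ M) (prod21 (Y x) (Y b) v) \<gamma>1 l1 \<gamma>2 l2)"
    by (rule mult_z12_funpow_pointwise [of "\<lambda>w. w" "scaleW c"])
      (simp_all add: W.scale_right_diff_distrib prod21_scale)
  then show "(mult_z12 ^^ M) (prod12 (Y (scaleV c x)) (Y b) v) \<gamma>1 l1 \<gamma>2 l2 =
      (mult_z12 ^^ M) (prod21 (Y (scaleV c x)) (Y b) v) \<gamma>1 l1 \<gamma>2 l2"
    using assms local_series_scale [of M b v c x]
    by (simp add: local_with_def local_series_def)
qed

lemma falling_op_jointly_local:
  assumes "x \<in> jointly_local M b m"
  shows "falling_op scaleV q \<N> j x \<in> jointly_local M b m"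
proof (rule nil.falling_op_closed [OF _ _ _ assms])
  show "\<N> y \<in> jointly_local M b m" if "y \<in> jointly_local M b m" for y
    using that eigenvector_\<N> unfolding jointly_local_def
    by (auto simp: funpow_swap1 [symmetric]) (metis funpow.simps(2) comp_apply)
qed (auto simp: jointly_local_def sem.add sem.scale \<N>_funpow_linear V.scale_right_distrib mult.commute
    local_with_add local_with_scale)

text \<open>
  The orbit of \<open>a\<close> under \<open>\<N>\<close> is finite, and the sum of the exponents for its members bounds each of them.
\<close>
lemma jointly_local_exists:
  assumes "\<sigma> a = scaleV (exp (- (2 * pi * \<i> * m))) a"
  obtains M where "a \<in> jointly_local M b m"
proof -
  obtain R where R: "(\<N> ^^ R) a = 0" using \<N>_nilpotent unfolding locally_nilpotent_op_def by blast
  have "\<exists>N. local_with N (Y x) (Y b)" for x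
    using Y_local unfolding local_collection_def local_pair_def by blast
  then have "\<exists>f. \<forall>r. local_with (f r) (Y ((\<N> ^^ r) a)) (Y b)" by (intro choice allI)
  then obtain f where f: "\<And>r. local_with (f r) (Y ((\<N> ^^ r) a)) (Y b)" by blast
  have "local_with (\<Sum>r\<le>R. f r) (Y ((\<N> ^^ r) a)) (Y b)" for r
  proof -
    have "(\<N> ^^ r) a = (\<N> ^^ min r R) a"
      using R \<N>_funpow_eq_0 [OF R, of r] by (simp add: min_def)
    moreover have "f (min r R) \<le> (\<Sum>r\<le>R. f r)" by (intro member_le_sum) auto
    ultimately show ?thesis using local_with_mono [OF f] by metis
  qed
  with assms that show ?thesis unfolding jointly_local_def by blast
qed

text \<open>
  The products of order \<open>M\<close> and higher vanish, so the sum stops at \<open>J\<close>. For a fixed exponent \<open>g\<close> of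
  \<open>z1\<close>, it is a Vandermonde sum of operators applied to \<open>a\<close>.
\<close>
lemma sum_iterated_products:
  assumes a: "a \<in> jointly_local M b m" and n: "n = int M - 1 - int J"
  shows "(\<Sum>j\<le>J. mode scaleW Y \<N> (m + k - of_nat j) (prd (n + int j) (binom_op scaleV m \<N> j a) b) v) =
    Sum_any (\<lambda>g. scaleW ((g + m) gchoose J) (local_series M b v a g 0 (of_nat J - 1 - m - k - g) 0))"
proof -
  interpret neg: linear_operator scaleV "\<lambda>x. - \<N> x" by (rule nil.linear_uminus)
  let ?F = "local_series M b v"
  let ?x = "\<lambda>g j. falling_op scaleV g (\<lambda>x. - \<N> x) (J - j) (falling_op scaleV m \<N> j a)"
  let ?h = "\<lambda>j g. ?F (scaleV (of_nat (J choose j)) (?x g j)) g 0 (of_nat J - 1 - m - k - g) 0"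
  have *: "mode scaleW Y \<N> (m + k - of_nat j) (prd (n + int j) (binom_op scaleV m \<N> j a) b) v =
      scaleW (1 / fact J) (Sum_any (?h j)) \<and> finite {g. ?h j g \<noteq> 0}" if "j \<le> J" for j
  proof -
    have "falling_op scaleV m \<N> j a \<in> jointly_local M b m" by (rule falling_op_jointly_local [OF a])
    then have "\<sigma> (binom_op scaleV m \<N> j a) = scaleV (exp (- (2 * pi * \<i> * m))) (binom_op scaleV m \<N> j a)"
      and "local_with M (Y (binom_op scaleV m \<N> j a)) (Y b)"
      unfolding jointly_local_def binom_op_def 
      by (auto simp: sem.scale mult.commute dest: spec [of _ 0] intro!: local_with_scale)
    note mode_product [OF this, where n = "n + int j" and p = "J - j" and v = v
        and q = "m + k - of_nat j"]
    moreover have "n + int j = int M - 1 - int (J - j)" using n that by simp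
    moreover have "of_nat (J - j) - 1 - (m + k - of_nat j) - g = of_nat J - 1 - m - k - g" for g :: complex
      using that by (simp add: of_nat_diff)
    moreover have "?F (falling_op scaleV g (\<lambda>x. - \<N> x) (J - j) (binom_op scaleV m \<N> j a)) g 0 \<gamma> 0 =
      scaleW (1 / fact j) (?F (?x g j) g 0 \<gamma> 0)" for g \<gamma>
      by (simp add: binom_op_def neg.falling_op_scale local_series_scale)
    ultimately have 1: "mode scaleW Y \<N> (m + k - of_nat j) (prd (n + int j) (binom_op scaleV m \<N> j a) b) v =
        scaleW (1 / fact (J - j)) (Sum_any (\<lambda>g. scaleW (1 / fact j) (?F (?x g j) g 0 (of_nat J - 1 - m - k - g) 0)))"
      and "finite {g. scaleW (1 / fact j) (?F (?x g j) g 0 (of_nat J - 1 - m - k - g) 0) \<noteq> 0}"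
      by simp_all
    then have fin: "finite {g. ?F (?x g j) g 0 (of_nat J - 1 - m - k - g) 0 \<noteq> 0}" by simp
    have hom: "Sum_any (\<lambda>g. scaleW c (?F (?x g j) g 0 (of_nat J - 1 - m - k - g) 0)) =
        scaleW c (Sum_any (\<lambda>g. ?F (?x g j) g 0 (of_nat J - 1 - m - k - g) 0))" for c
      by (rule Sum_any_hom [OF fin, symmetric]) (simp_all add: W.scale_right_distrib)
    have "1 / fact (J - j) * (1 / fact j) = (1 / fact J * of_nat (J choose j) :: complex)"
      using that by (simp add: binomial_fact)
    then show ?thesis
      unfolding 1 local_series_scale hom using fields.finite_scale_support [OF fin]
      by (simp only: W.scale_scale)
  qed
  have "(\<Sum>j\<le>J. mode scaleW Y \<N> (m + k - of_nat j) (prd (n + int j) (binom_op scaleV m \<N> j a) b) v) =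
     scaleW (1 / fact J) (\<Sum>j\<le>J. Sum_any (?h j))"
    unfolding W.scale_sum_right using * by (intro sum.cong) auto
  also have "(\<Sum>j\<le>J. Sum_any (?h j)) = Sum_any (\<lambda>g. \<Sum>j\<le>J. ?h j g)"
    using * by (intro Sum_any_sum_swap) auto
  also have "(\<lambda>g. \<Sum>j\<le>J. ?h j g) =
      (\<lambda>g. scaleW (\<Prod>i<J. g + m - of_nat i) (?F a g 0 (of_nat J - 1 - m - k - g) 0))"
    unfolding local_series_sum [symmetric] unfolding nil.falling_op_Vandermonde
    unfolding local_series_scale ..
  also have "scaleW (1 / fact J) (Sum_any \<dots>) =
      Sum_any (\<lambda>g. scaleW (1 / fact J) (scaleW (\<Prod>i<J. g + m - of_nat i) (?F a g 0 (of_nat J - 1 - m - k - g) 0)))"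
  proof (rule Sum_any_hom)
    have "cone_supported (?F a)"
      unfolding local_series_def
      using a by (intro fields.local_product_cone_supported Y_field) (auto simp: jointly_local_def dest: spec [of _ 0])
    then have "finite {g. ?F a g 0 (of_nat J - 1 - m - k - g) 0 \<noteq> 0}"
      by (intro finite_subset [OF _ cone_supported_finite]) auto
    then show "finite {g. scaleW (\<Prod>i<J. g + m - of_nat i) (?F a g 0 (of_nat J - 1 - m - k - g) 0) \<noteq> 0}"
      by (rule fields.finite_scale_support)
  qed (simp_all add: W.scale_right_distrib)
  also have "\<dots> = Sum_any (\<lambda>g. scaleW ((g + m) gchoose J) (?F a g 0 (of_nat J - 1 - m - k - g) 0))"
    by (simp add: gbinomial_prod_rev atLeast0LessThan)
  finally show ?thesis .
qed

section \<open>The Borcherds identity\<close>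

text \<open>
  Both sides are evaluated in terms of the series $F_a$: the left-hand side through the two residues, the
  right-hand side through the diagonal.
\<close>
lemma Borcherds_identity:
  fixes m k :: complex and n :: int and a b :: 'v and v :: 'w
  assumes a: "\<sigma> a = scaleV (exp (- (2 * pi * \<i> * m))) a"
  defines "ab \<equiv> \<lambda>i::nat. scaleW ((-1) ^ i * (of_int n gchoose i))
      (mode scaleW Y \<N> (m + of_int n - of_nat i) a (mode scaleW Y \<N> (k + of_nat i) b v))"
    and "ba \<equiv> \<lambda>i::nat. scaleW ((-1) powi (n + int i) * (of_int n gchoose i))
      (mode scaleW Y \<N> (k + of_int n - of_nat i) b (mode scaleW Y \<N> (m + of_nat i) a v))"
    and "comm \<equiv> \<lambda>j::nat. mode scaleW Y \<N> (m + k - of_nat j)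
      (prd (n + int j) (binom_op scaleV m \<N> j a) b) v"
  shows "finite {i. ab i \<noteq> 0} \<and> finite {i. ba i \<noteq> 0} \<and> finite {j. comm j \<noteq> 0} \<and>
    Sum_any ab - Sum_any ba = Sum_any comm"
proof -
  let ?P = "prod12 (Y a) (Y b) v" and ?Q = "prod21 (Y a) (Y b) v"
  obtain M where M: "a \<in> jointly_local M b m" using jointly_local_exists [OF a] .
  then have loc: "local_with M (Y a) (Y b)" by (auto simp: jointly_local_def dest: spec [of _ 0])
  let ?F = "local_series M b v a"
  obtain S T where S: "finite S" "\<And>\<gamma> l. Y a v \<gamma> l \<noteq> 0 \<Longrightarrow> \<gamma> \<in> cone S"
    and T: "finite T" "\<And>\<gamma> l. Y b v \<gamma> l \<noteq> 0 \<Longrightarrow> \<gamma> \<in> cone T"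
    using fields.LFie_support [OF Y_field, of a v] fields.LFie_support [OF Y_field, of b v] by metis
  have P: "supported_in UNIV (cone T) ?P" using T(2) by (rule fields.prod12_support [OF Y_field])
  have Q: "supported_in (cone S) UNIV ?Q" using S(2) by (rule fields.prod21_support [OF Y_field])
  have ab: "ab = (\<lambda>i. scaleW ((-1) ^ i * (of_int n gchoose i))
     (?P (- 1 - (m + of_int n - of_nat i)) 0 (- 1 - (k + of_nat i)) 0))"
    by (simp add: ab_def mode_eq prod12_def)
  have ba: "ba = (\<lambda>i. scaleW ((-1) powi (n + int i) * (of_int n gchoose i))
     (?Q (- 1 - (m + of_nat i)) 0 (- 1 - (k + of_int n - of_nat i)) 0))"
    by (simp add: ba_def mode_eq prod21_def)
  have fin_ab: "finite {i. ab i \<noteq> 0}"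
    unfolding ab by (rule fields.finite_scale_support [OF fields.finite_res12 [OF P T(1)]])
  have fin_ba: "finite {i. ba i \<noteq> 0}"
    unfolding ba by (rule fields.finite_scale_support [OF fields.finite_res21 [OF Q S(1)]])
  have "Sum_any ab = fields.res12 n m k ?P" by (simp add: ab fields.res12_def)
  also have "\<dots> = fields.res12 (n - int M) m k ?F"
    using fields.res12_mult_z12_funpow [OF P T(1)] by (simp add: local_series_def)
  finally have sum_ab: "Sum_any ab = fields.res12 (n - int M) m k ?F" .
  have "Sum_any ba = fields.res21 n m k ?Q" by (simp add: ba fields.res21_def)
  also have "\<dots> = fields.res21 (n - int M) m k ?F"
    using fields.res21_mult_z12_funpow [OF Q S(1)] loc by (simp add: local_series_def local_with_def)
  finally have sum_ba: "Sum_any ba = fields.res21 (n - int M) m k ?F" .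
  have comm_0: "comm j = 0" if "n + int j \<ge> int M" for j
  proof -
    have "local_with M (Y (binom_op scaleV m \<N> j a)) (Y b)"
      using falling_op_jointly_local [OF M, of m j]
      by (auto simp: jointly_local_def binom_op_def dest: spec [of _ 0] intro!: local_with_scale)
    with that show ?thesis by (simp add: comm_def mode_product_eq_0)
  qed
  show ?thesis
  proof (cases "n \<ge> int M")
    case True
    then have "comm j = 0" for j by (intro comm_0) simp
    moreover have "Sum_any ab = Sum_any ba"
      using True by (simp add: sum_ab sum_ba fields.res12_eq_res21)
    ultimately show ?thesis using fin_ab fin_ba by simp
  next
    case False
    define J where "J = nat (int M - 1 - n)"
    have J: "n = int M - 1 - int J" using False by (simp add: J_def)
    have sub: "{j. comm j \<noteq> 0} \<subseteq> {..J}"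
    proof
      fix j assume "j \<in> {j. comm j \<noteq> 0}"
      then have "\<not> n + int j \<ge> int M" using comm_0 by blast
      then show "j \<in> {..J}" using J by simp
    qed
    have supp: "cone_supported ?F"
      unfolding local_series_def by (rule fields.local_product_cone_supported [OF Y_field Y_field loc])
    have "Sum_any comm = (\<Sum>j\<le>J. comm j)" using sub by (intro Sum_any.expand_superset) simp
    also have "\<dots> = Sum_any (\<lambda>g. scaleW ((g + m) gchoose J) (?F g 0 (of_nat J - 1 - m - k - g) 0))"
      unfolding comm_def by (rule sum_iterated_products [OF M J])
    also have "\<dots> = fields.res12 (- 1 - int J) m k ?F - fields.res21 (- 1 - int J) m k ?F"
      by (rule fields.res12_diff_res21 [OF supp, symmetric]) (rule local_series_coset [OF a])
    also have "\<dots> = Sum_any ab - Sum_any ba" by (simp add: sum_ab sum_ba J)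
    finally show ?thesis using fin_ab fin_ba finite_subset [OF sub] by simp
  qed
qed

end

theorem theorem5p2:
  fixes scaleV :: "complex \<Rightarrow> 'v::ab_group_add \<Rightarrow> 'v"
    and vac :: 'v
    and prd :: "int \<Rightarrow> 'v \<Rightarrow> 'v \<Rightarrow> 'v"
    and scaleW :: "complex \<Rightarrow> 'w::ab_group_add \<Rightarrow> 'w"
    and \<phi> \<sigma> \<N> :: "'v \<Rightarrow> 'v"
    and Y :: "'v \<Rightarrow> 'w lfield"
    and \<alpha> \<beta> :: "complex set"
    and m k :: complex
    and n :: int
    and a b :: 'v
    and v :: 'w
  assumes "vertex_algebra scaleV vac prd"
    and "\<phi> \<in> Aut scaleV prd"
    and "locally_finite_op scaleV \<phi>"
    and "twisted_module scaleV vac prd scaleW \<phi> Y"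
    and "\<sigma> \<in> Aut scaleV prd"
    and "semisimple_op scaleV \<sigma>"
    and "\<N> \<in> Der scaleV prd"
    and "locally_nilpotent_op \<N>"
    and "\<sigma> \<circ> \<N> = \<N> \<circ> \<sigma>"
    and "\<phi> = \<sigma> \<circ> exp_op scaleV (- (2 * pi * \<i>)) \<N>"
    and "\<alpha> \<in> CmodZ"
    and "\<beta> \<in> CmodZ"
    and "a \<in> eigenspace_mod scaleV \<sigma> \<alpha>"
    and "b \<in> eigenspace_mod scaleV \<sigma> \<beta>"
    and "m \<in> \<alpha>"
    and "k \<in> \<beta>"
  defines "ab \<equiv> \<lambda>i::nat. scaleW ((-1) ^ i * (of_int n gchoose i))
      (mode scaleW Y \<N> (m + of_int n - of_nat i) a (mode scaleW Y \<N> (k + of_nat i) b v))"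
    and "ba \<equiv> \<lambda>i::nat. scaleW ((-1) powi (n + int i) * (of_int n gchoose i))
      (mode scaleW Y \<N> (k + of_int n - of_nat i) b (mode scaleW Y \<N> (m + of_nat i) a v))"
    and "comm \<equiv> \<lambda>j::nat. mode scaleW Y \<N> (m + k - of_nat j)
      (prd (n + int j) (binom_op scaleV m \<N> j a) b) v"
  shows "finite {i. ab i \<noteq> 0} \<and> finite {i. ba i \<noteq> 0} \<and> finite {j. comm j \<noteq> 0} \<and>
    Sum_any ab - Sum_any ba = Sum_any comm"
proof -
  have \<sigma>: "Vector_Spaces.linear scaleV scaleV \<sigma>"
    using \<open>\<sigma> \<in> Aut scaleV prd\<close> by (simp add: Aut_def)
  have \<N>: "Vector_Spaces.linear scaleV scaleV \<N>"
    using \<open>\<N> \<in> Der scaleV prd\<close> by (simp add: Der_def)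
  have comm: "\<sigma> (\<N> x) = \<N> (\<sigma> x)" for x
    using fun_cong [OF \<open>\<sigma> \<circ> \<N> = \<N> \<circ> \<sigma>\<close>, of x] by simp
  have \<phi>: "\<phi> x = \<sigma> (exp_op scaleV (- (2 * pi * \<i>)) \<N> x)" for x
    using fun_cong [OF \<open>\<phi> = \<sigma> \<circ> exp_op scaleV (- (2 * pi * \<i>)) \<N>\<close>, of x] by simp
  interpret log_twisted_module scaleV vac prd scaleW \<phi> Y \<sigma> \<N>
    by (intro log_twisted_module.intro log_twisted_module_axioms.intro)
      (fact \<open>twisted_module scaleV vac prd scaleW \<phi> Y\<close> \<sigma> \<N>
        \<open>locally_nilpotent_op \<N>\<close> comm \<phi>)+
  have "\<sigma> a = scaleV (exp (- (2 * pi * \<i> * m))) a"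
    using \<open>a \<in> eigenspace_mod scaleV \<sigma> \<alpha>\<close> \<open>m \<in> \<alpha>\<close> by (simp add: eigenspace_mod_def)
  then show ?thesis unfolding ab_def ba_def comm_def by (rule Borcherds_identity)
qed

end
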